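(* The subset of the fundamental alcove $\mathcal{A}_0$ defined by $$F_{P^\vee}:=\{\lambda\in\mathcal{A}_0 : \forall i\in J,\ \langle\lambda,\alpha_i+\alpha_0\rangle\le1\}$$ is a fundamental domain for the action of $\Omega$ on $\mathcal{A}_0$. Moreover, for $\lambda\in F_{P^\vee}$, the elements $\omega_i^{-1}\in\Omega$ ($i\in J$) that send $\lambda$ into $F_{P^\vee}$ are precisely those with $\langle\lambda,\alpha_i+\alpha_0\rangle=1$. In particular, if $\lambda$ is an interior point of $F_{P^\vee}$ and $1\ne\widehat{w}\in\widehat{W}_{\mathrm a}$, then $\widehat{w}(\lambda)\notin F_{P^\vee}$.
   Context: $\Phi$ is a reduced crystallographic irreducible root system in $V=\mathbb{R}\Phi$, with simple system $\Pi=\{\alpha_1,\dots,\alpha_r\}$, $I=\{1,\dots,r\}$, Weyl group $W$, highest root $\alpha_0=\sum_{i\in I}n_i\alpha_i$, and $J=\{i\in I:n_i=1\}$. $V^*$ is the dual of $V$, with pairing $\langle\cdot,\cdot\rangle:V^*\times V\to\mathbb{R}$. Fundamental coweights $\varpi_i^\vee\in V^*$: $\langle\varpi_i^\vee,\alpha_k\rangle=\delta_{i,k}$; coweight lattice $P^\vee=\bigoplus_i\mathbb{Z}\varpi_i^\vee$. $\mathrm{t}_v$ denotes the translation by $v$. The extended affine Weyl group is $\widehat{W}_{\mathrm a}=\mathrm{t}(P^\vee)\rtimes W$, acting on $V^*$ by affine transformations. Fundamental alcove: $\mathcal{A}_0=\{\lambda\in V^*:\langle\lambda,\alpha\rangle\ge0\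 \forall\alpha\in\Pi,\ \langle\lambda,\alpha_0\rangle\le1\}$, and $\Omega=\{\phi\in\widehat{W}_{\mathrm a}:\phi(\mathcal{A}_0)=\mathcal{A}_0\}$. For $i\in J$, $\omega_i:=\mathrm{t}_{\varpi_i^\vee}w_i\in\Omega$ with $w_i=w_0^iw_0$, where $w_0$ is the longest element of $W$ and $w_0^i$ the longest element of the parabolic subgroup $W_i$ generated by the simple reflections $s_{\alpha_k}$, $k\ne i$. It is known that $i\mapsto\omega_i$ is a bijection $J\to\Omega\setminus\{1\}$. A fundamental domain for the action of a discrete group $G$ on a topological space $Z$ is a closed connected subspace $\mathcal{F}\subseteq Z$ such that $\mathcal{F}\cap g\mathcal{F}$ has empty interior (in $Z$) for every $1\ne g\in G$, and $Z=\bigcup_{g\in G}g\mathcal{F}$. "Interior point" of the polytope $F_{P^\vee}$ means interior in $V^*$. *)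

theory Defs
  imports "HOL-Analysis.Analysis"
begin

text \<open>
  The ambient space \<open>V\<close> is a Euclidean space \<open>'a\<close>; its inner product is the one for which the
  reflections of the root system are orthogonal.  The dual \<open>V\<^sup>*\<close> is the space \<open>'a \<Rightarrow>\<^sub>L real\<close> of
  (automatically bounded) linear functionals with its norm topology, and the pairing of
  \<open>\<mu>\<close> and \<open>v\<close> is \<open>blinfun_apply \<mu> v\<close>.
\<close>

section \<open>Root systems\<close>

definition root_refl :: "'a::euclidean_space \<Rightarrow> 'a \<Rightarrow> 'a" where
  "root_refl a v = v - (2 * (v \<bullet> a) / (a \<bullet> a)) *\<^sub>R a"

definition root_system :: "'a::euclidean_space set \<Rightarrow> bool" where
  "root_system \<Phi> \<longleftrightarrow>
     finite \<Phi> \<and> 0 \<notin> \<Phi> \<and> span \<Phi> = UNIV \<and> (\<forall>a\<in>\<Phi>. root_refl a ` \<Phi> = \<Phi>)"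

definition reduced_roots :: "'a::euclidean_space set \<Rightarrow> bool" where
  "reduced_roots \<Phi> \<longleftrightarrow> (\<forall>a\<in>\<Phi>. \<forall>c::real. c *\<^sub>R a \<in> \<Phi> \<longrightarrow> c = 1 \<or> c = - 1)"

definition crystallographic :: "'a::euclidean_space set \<Rightarrow> bool" where
  "crystallographic \<Phi> \<longleftrightarrow> (\<forall>a\<in>\<Phi>. \<forall>b\<in>\<Phi>. 2 * (b \<bullet> a) / (a \<bullet> a) \<in> \<int>)"

definition irreducible_roots :: "'a::euclidean_space set \<Rightarrow> bool" where
  "irreducible_roots \<Phi> \<longleftrightarrow> \<Phi> \<noteq> {} \<and>
     \<not> (\<exists>A B. A \<noteq> {} \<and> B \<noteq> {} \<and> A \<union> B = \<Phi> \<and> A \<inter> B = {} \<and> (\<forall>a\<in>A. \<forall>b\<in>B. a \<bullet> b = 0))"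

text \<open>
  A simple system is enumerated as \<open>\<alpha> 1, \<dots>, \<alpha> r\<close>; values of \<open>\<alpha>\<close> outside \<open>{1..r}\<close> are irrelevant.
  The coefficients are only required to be real; for crystallographic systems they are integers.
\<close>

definition simple_system :: "'a::euclidean_space set \<Rightarrow> nat \<Rightarrow> (nat \<Rightarrow> 'a) \<Rightarrow> bool" where
  "simple_system \<Phi> r \<alpha> \<longleftrightarrow>
     \<alpha> ` {1..r} \<subseteq> \<Phi> \<and> inj_on \<alpha> {1..r} \<and> independent (\<alpha> ` {1..r}) \<and>
     (\<forall>b\<in>\<Phi>. \<exists>c :: nat \<Rightarrow> real. b = (\<Sum>i\<in>{1..r}. c i *\<^sub>R \<alpha> i) \<and>
        ((\<forall>i\<in>{1..r}. c i \<ge> 0) \<or> (\<forall>i\<in>{1..r}. c i \<le> 0)))"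

definition highest_root ::
  "'a::euclidean_space set \<Rightarrow> nat \<Rightarrow> (nat \<Rightarrow> 'a) \<Rightarrow> 'a \<Rightarrow> bool" where
  "highest_root \<Phi> r \<alpha> \<theta> \<longleftrightarrow> \<theta> \<in> \<Phi> \<and>
     (\<forall>b\<in>\<Phi>. \<exists>c :: nat \<Rightarrow> real. (\<forall>i\<in>{1..r}. c i \<ge> 0) \<and> \<theta> - b = (\<Sum>i\<in>{1..r}. c i *\<^sub>R \<alpha> i))"

section \<open>Weyl groups\<close>

text \<open>
  Only applied to sets of reflections, which are involutions, so that the products of words
  in the generators already form the generated group.
\<close>

definition words :: "('b \<Rightarrow> 'b) set \<Rightarrow> ('b \<Rightarrow> 'b) set" where
  "words S = {foldr (\<circ>) xs id | xs. set xs \<subseteq> S}"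

definition word_length :: "('b \<Rightarrow> 'b) set \<Rightarrow> ('b \<Rightarrow> 'b) \<Rightarrow> nat" where
  "word_length S w = (LEAST m. \<exists>xs. set xs \<subseteq> S \<and> length xs = m \<and> foldr (\<circ>) xs id = w)"

definition weyl_group :: "'a::euclidean_space set \<Rightarrow> ('a \<Rightarrow> 'a) set" where
  "weyl_group \<Phi> = words (root_refl ` \<Phi>)"

definition simple_refls :: "(nat \<Rightarrow> 'a::euclidean_space) \<Rightarrow> nat set \<Rightarrow> ('a \<Rightarrow> 'a) set" where
  "simple_refls \<alpha> K = (\<lambda>k. root_refl (\<alpha> k)) ` K"

definition parabolic :: "nat \<Rightarrow> (nat \<Rightarrow> 'a::euclidean_space) \<Rightarrow> nat \<Rightarrow> ('a \<Rightarrow> 'a) set" where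
  "parabolic r \<alpha> i = words (simple_refls \<alpha> ({1..r} - {i}))"

definition longest_in ::
  "nat \<Rightarrow> (nat \<Rightarrow> 'a::euclidean_space) \<Rightarrow> ('a \<Rightarrow> 'a) set \<Rightarrow> 'a \<Rightarrow> 'a" where
  "longest_in r \<alpha> G = (ARG_MAX (word_length (simple_refls \<alpha> {1..r})) w. w \<in> G)"

text \<open>The contragredient action on the dual space.\<close>

definition dual_act ::
  "('a \<Rightarrow> 'a) \<Rightarrow> ('a::euclidean_space \<Rightarrow>\<^sub>L real) \<Rightarrow> ('a \<Rightarrow>\<^sub>L real)" where
  "dual_act w \<mu> = Blinfun (\<lambda>v. blinfun_apply \<mu> (inv w v))"

section \<open>The extended affine Weyl group\<close>

definition coweight ::
  "nat \<Rightarrow> (nat \<Rightarrow> 'a::euclidean_space) \<Rightarrow> nat \<Rightarrow> ('a \<Rightarrow>\<^sub>L real)" where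
  "coweight r \<alpha> i =
     (THE f. \<forall>k\<in>{1..r}. blinfun_apply f (\<alpha> k) = (if i = k then 1 else 0))"

definition coweight_lattice ::
  "nat \<Rightarrow> (nat \<Rightarrow> 'a::euclidean_space) \<Rightarrow> ('a \<Rightarrow>\<^sub>L real) set" where
  "coweight_lattice r \<alpha> =
     {(\<Sum>i\<in>{1..r}. of_int (c i) *\<^sub>R coweight r \<alpha> i) | c :: nat \<Rightarrow> int. True}"

definition ext_affine_weyl ::
  "'a::euclidean_space set \<Rightarrow> nat \<Rightarrow> (nat \<Rightarrow> 'a) \<Rightarrow> (('a \<Rightarrow>\<^sub>L real) \<Rightarrow> ('a \<Rightarrow>\<^sub>L real)) set" where
  "ext_affine_weyl \<Phi> r \<alpha> =
     {(\<lambda>\<mu>. v + dual_act w \<mu>) | v w. v \<in> coweight_lattice r \<alpha> \<and> w \<in> weyl_group \<Phi>}"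

definition alcove ::
  "nat \<Rightarrow> (nat \<Rightarrow> 'a::euclidean_space) \<Rightarrow> 'a \<Rightarrow> ('a \<Rightarrow>\<^sub>L real) set" where
  "alcove r \<alpha> \<theta> =
     {\<mu>. (\<forall>i\<in>{1..r}. blinfun_apply \<mu> (\<alpha> i) \<ge> 0) \<and> blinfun_apply \<mu> \<theta> \<le> 1}"

definition alcove_stab ::
  "'a::euclidean_space set \<Rightarrow> nat \<Rightarrow> (nat \<Rightarrow> 'a) \<Rightarrow> 'a \<Rightarrow>
     (('a \<Rightarrow>\<^sub>L real) \<Rightarrow> ('a \<Rightarrow>\<^sub>L real)) set" where
  "alcove_stab \<Phi> r \<alpha> \<theta> =
     {\<phi> \<in> ext_affine_weyl \<Phi> r \<alpha>. \<phi> ` alcove r \<alpha> \<theta> = alcove r \<alpha> \<theta>}"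

definition omega ::
  "'a::euclidean_space set \<Rightarrow> nat \<Rightarrow> (nat \<Rightarrow> 'a) \<Rightarrow> nat \<Rightarrow> ('a \<Rightarrow>\<^sub>L real) \<Rightarrow> ('a \<Rightarrow>\<^sub>L real)" where
  "omega \<Phi> r \<alpha> i = (\<lambda>\<mu>. coweight r \<alpha> i +
     dual_act (longest_in r \<alpha> (parabolic r \<alpha> i) \<circ> longest_in r \<alpha> (weyl_group \<Phi>)) \<mu>)"

section \<open>Fundamental domains\<close>

text \<open>
  A group acting on \<open>X\<close> is given as a set of transformations of the type underlying \<open>X\<close>, with
  neutral element \<open>id\<close>; the group itself is discrete, so no topology on it appears.
\<close>

definition acts_on :: "('b \<Rightarrow> 'b) set \<Rightarrow> 'b topology \<Rightarrow> bool" where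
  "acts_on G X \<longleftrightarrow> id \<in> G \<and> (\<forall>g\<in>G. \<forall>h\<in>G. g \<circ> h \<in> G) \<and>
     (\<forall>g\<in>G. \<exists>h\<in>G. h \<circ> g = id \<and> g \<circ> h = id) \<and> (\<forall>g\<in>G. homeomorphic_map X X g)"

definition fundamental_domain :: "('b \<Rightarrow> 'b) set \<Rightarrow> 'b topology \<Rightarrow> 'b set \<Rightarrow> bool" where
  "fundamental_domain G X F \<longleftrightarrow> acts_on G X \<and> closedin X F \<and> connectedin X F \<and>
     (\<forall>g\<in>G. g \<noteq> id \<longrightarrow> X interior_of (F \<inter> g ` F) = {}) \<and> topspace X = (\<Union>g\<in>G. g ` F)"

text \<open>The argument \<open>J\<close> is the set of indices \<open>i\<close> with \<open>n\<^sub>i = 1\<close>.\<close>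

definition F_coweight ::
  "nat \<Rightarrow> (nat \<Rightarrow> 'a::euclidean_space) \<Rightarrow> 'a \<Rightarrow> nat set \<Rightarrow> ('a \<Rightarrow>\<^sub>L real) set" where
  "F_coweight r \<alpha> \<theta> J =
     {\<mu> \<in> alcove r \<alpha> \<theta>. \<forall>i\<in>J. blinfun_apply \<mu> (\<alpha> i + \<theta>) \<le> 1}"

end

theory Submission imports Defs begin

text \<open>
  Write \<open>\<theta>\<close> for the highest root, \<open>A\<close> for the alcove and \<open>\<Omega>\<close> for its stabilizer in the extended affine
  Weyl group. The alcove is cut out by \<open>a\<^sub>k \<ge> 0\<close>, where \<open>a\<^sub>k\<close> is the pairing with the simple root
  \<open>\<alpha> k\<close> for \<open>k\<close> in \<open>{1..r}\<close>, and \<open>a\<^sub>0 = 1 - \<theta>\<close>; the condition of index \<open>i\<close> in the definition of \<open>F\<close>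
  is \<open>a\<^sub>i \<le> a\<^sub>0\<close>.

  The stabilizer consists of the identity and the elements \<open>\<omega>\<^sub>i\<close> with \<open>i \<in> J\<close> (\<open>stab_cases\<close>),
  and \<open>a\<^sub>i \<circ> \<omega>\<^sub>i = a\<^sub>0\<close> (\<open>omega_special\<close>). Hence \<open>F\<close> consists of the points of \<open>A\<close> at which \<open>a\<^sub>0\<close>
  is largest, that is, \<open>\<theta>\<close> is smallest, on the \<open>\<Omega>\<close>-orbit (\<open>F_iff\<close>). As \<open>\<Omega>\<close> is finite, every orbit in \<open>A\<close>
  meets \<open>F\<close>. If \<open>\<mu>\<close> lies in \<open>F\<close> and in \<open>\<omega>\<^sub>i F\<close>, then \<open>a\<^sub>0\<close> takes the same value at \<open>\<mu>\<close> and at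
  \<open>\<omega>\<^sub>i\<^sup>-\<^sup>1 \<mu>\<close>, which means \<open>a\<^sub>i \<mu> = a\<^sub>0 \<mu>\<close>; this hyperplane misses \<open>0 \<in> A\<close>, so the
  overlap has empty interior in the convex set \<open>A\<close>. The same equality decides whether
  \<open>\<omega>\<^sub>i\<^sup>-\<^sup>1 \<mu>\<close> lies in \<open>F\<close>.

  An element of the extended affine Weyl group permutes the hyperplanes on which a root takes a
  given integer value, and none of these meets the open alcove. So if the element moves one point
  of the open alcove into \<open>A\<close>, it stabilizes \<open>A\<close> (\<open>ext_affine_stab\<close>). This reduces the statement about
  interior points to \<open>\<Omega>\<close>, and it also shows \<open>\<omega>\<^sub>i \<in> \<Omega>\<close>.

  The description of \<open>\<Omega>\<close> rests on the exchange property of words in the simple reflections. It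
  implies that an element of the Weyl group that makes no simple root negative is the identity,
  so an element of \<open>\<Omega>\<close> is determined by its value at \<open>0\<close>, which can only be \<open>0\<close> or a fundamental
  coweight of index in \<open>J\<close>. It also implies that a longest element of the Weyl group, or of a
  parabolic subgroup, makes the corresponding simple roots negative, and from this
  \<open>w\<^sub>0\<^sup>-\<^sup>1 \<theta> = - \<theta>\<close> and \<open>(w\<^sub>0\<^sup>i)\<^sup>-\<^sup>1 (\<alpha> i) = \<theta>\<close> follow.
\<close>

section \<open>Words in a set of transformations\<close>

lemma foldr_comp_append:
  "foldr (\<circ>) (xs @ ys) id = foldr (\<circ>) xs id \<circ> foldr (\<circ>) ys id"
  by (induction xs) (simp_all add: comp_assoc)

lemma words_id: "id \<in> words S"
  unfolding words_def by (rule CollectI, rule exI[of _ "[]"]) simp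

lemma words_gen: "s \<in> S \<Longrightarrow> s \<in> words S"
  unfolding words_def by (rule CollectI, rule exI[of _ "[s]"]) simp

lemma words_comp: "f \<in> words S \<Longrightarrow> g \<in> words S \<Longrightarrow> f \<circ> g \<in> words S"
proof -
  assume "f \<in> words S" "g \<in> words S"
  then obtain xs ys where "set xs \<subseteq> S" "f = foldr (\<circ>) xs id" "set ys \<subseteq> S" "g = foldr (\<circ>) ys id"
    unfolding words_def by blast
  then show "f \<circ> g \<in> words S"
    unfolding words_def by (intro CollectI exI[of _ "xs @ ys"] conjI) (simp_all only: foldr_comp_append set_append Un_least)
qed

lemma words_induct [consumes 1, case_names id comp]:
  assumes "w \<in> words S" and "P id"
    and "\<And>s w. s \<in> S \<Longrightarrow> w \<in> words S \<Longrightarrow> P w \<Longrightarrow> P (s \<circ> w)"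
  shows "P w"
proof -
  have "P (foldr (\<circ>) xs id)" if "set xs \<subseteq> S" for xs
    using that
  proof (induction xs)
    case Nil
    then show ?case using assms(2) by (simp add: id_def)
  next
    case (Cons s xs)
    have "foldr (\<circ>) xs id \<in> words S" using Cons.prems unfolding words_def by auto
    then have "P (s \<circ> foldr (\<circ>) xs id)" using assms(3) Cons.IH Cons.prems by (metis insert_subset list.set(2))
    then show ?case by (simp only: foldr_Cons o_def[of "(\<circ>) s"])
  qed
  then show ?thesis using assms(1) by (auto simp: words_def)
qed

lemma words_least:
  assumes "S \<subseteq> words T" shows "words S \<subseteq> words T"
proof
  fix w assume "w \<in> words S"
  then show "w \<in> words T"
    by (induction rule: words_induct) (use assms words_id words_comp in blast)+
qed

lemma words_inverse:
  assumes "\<And>s. s \<in> S \<Longrightarrow> s \<circ> s = id" and "w \<in> words S"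
  shows "\<exists>w'\<in>words S. w' \<circ> w = id \<and> w \<circ> w' = id"
  using assms(2)
proof (induction rule: words_induct)
  case id
  then show ?case using words_id by (intro bexI[of _ id]) auto
next
  case (comp s w)
  then obtain w' where w': "w' \<in> words S" "w' \<circ> w = id" "w \<circ> w' = id" by blast
  have ss: "s (s x) = x" for x using assms(1)[OF comp(1)] by (metis comp_apply id_apply)
  have "w' \<circ> s \<in> words S" using w'(1) comp(1) words_gen words_comp by blast
  moreover have "(w' \<circ> s) \<circ> (s \<circ> w) = id"
    using w'(2) ss by (auto simp: fun_eq_iff)
  moreover have "(s \<circ> w) \<circ> (w' \<circ> s) = id"
    using w'(3) ss by (auto simp: fun_eq_iff)
  ultimately show ?case by blast
qed

lemma word_length_le:
  assumes "set xs \<subseteq> S" "foldr (\<circ>) xs id = w"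
  shows "word_length S w \<le> length xs"
  unfolding word_length_def by (rule Least_le) (use assms in blast)

lemma word_length_witness:
  assumes "w \<in> words S"
  obtains xs where "set xs \<subseteq> S" "length xs = word_length S w" "foldr (\<circ>) xs id = w"
proof -
  have "\<exists>m xs. set xs \<subseteq> S \<and> length xs = m \<and> foldr (\<circ>) xs id = w"
    using assms by (auto simp: words_def)
  from LeastI_ex[OF this] show ?thesis using that unfolding word_length_def by blast
qed

section \<open>Reflections\<close>

lemma linear_root_refl: "linear (root_refl a)"
proof (rule linearI)
  show "root_refl a (v + w) = root_refl a v + root_refl a w" for v w
    by (simp add: root_refl_def inner_add_left distrib_left add_divide_distrib scaleR_add_left)
  show "root_refl a (c *\<^sub>R v) = c *\<^sub>R root_refl a v" for c v
    by (simp add: root_refl_def scaleR_diff_right)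
qed

lemma root_refl_self: "a \<noteq> 0 \<Longrightarrow> root_refl a a = - a"
  by (simp add: root_refl_def scaleR_2)

lemma root_refl_inner: "root_refl a v \<bullet> root_refl a w = v \<bullet> w"
proof (cases "a = 0")
  case False
  define c d where "c = 2 * (v \<bullet> a) / (a \<bullet> a)" and "d = 2 * (w \<bullet> a) / (a \<bullet> a)"
  have "c * (a \<bullet> a) = 2 * (v \<bullet> a)" "d * (v \<bullet> a) = c * (w \<bullet> a)"
    using False by (simp_all add: c_def d_def)
  moreover have "root_refl a v \<bullet> root_refl a w
      = v \<bullet> w - d * (v \<bullet> a) - c * (w \<bullet> a) + d * (c * (a \<bullet> a))"
    by (simp add: root_refl_def c_def d_def inner_diff_left inner_diff_right inner_commute[of a w])
  ultimately show ?thesis by simp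
qed (simp add: root_refl_def)

lemma root_refl_involution: "root_refl a (root_refl a v) = v"
proof (cases "a = 0")
  case False
  then have "root_refl a v \<bullet> a = - (v \<bullet> a)"
    by (simp add: root_refl_def inner_diff_left)
  then show ?thesis
    by (simp add: root_refl_def[of a "root_refl a v"]) (simp add: root_refl_def)
qed (simp add: root_refl_def)

text \<open>An orthogonal map \<open>w\<close> conjugates the reflection in \<open>b\<close> to the reflection in \<open>w b\<close>.\<close>

lemma root_refl_conjugate:
  assumes "linear w" and "\<And>x y. w x \<bullet> w y = x \<bullet> y"
  shows "root_refl (w b) (w v) = w (root_refl b v)"
  by (simp add: root_refl_def assms linear_diff linear_scale)

section \<open>Root systems with a simple system\<close>

text \<open>
  A reduced crystallographic root system with an enumerated simple system. Throughout, \<open>W\<close> is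
  the Weyl group, \<open>\<sigma> k\<close> and \<open>S\<close> are the simple reflections, and \<open>cw i\<close> is a fundamental
  coweight.
\<close>

locale based_root_system =
  fixes \<Phi> :: "'a::euclidean_space set" and r :: nat and \<alpha> :: "nat \<Rightarrow> 'a"
  assumes root_system: "root_system \<Phi>"
    and reduced: "reduced_roots \<Phi>"
    and crystallographic: "crystallographic \<Phi>"
    and simple_system: "simple_system \<Phi> r \<alpha>"
begin

abbreviation W where "W \<equiv> weyl_group \<Phi>"
abbreviation \<sigma> where "\<sigma> k \<equiv> root_refl (\<alpha> k)"
abbreviation S where "S \<equiv> simple_refls \<alpha> {1..r}"
abbreviation cw where "cw \<equiv> coweight r \<alpha>"

lemma finite_roots: "finite \<Phi>" and zero_not_root: "0 \<notin> \<Phi>" and span_roots: "span \<Phi> = UNIV"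
  using root_system unfolding root_system_def by blast+

lemma refl_root: "a \<in> \<Phi> \<Longrightarrow> b \<in> \<Phi> \<Longrightarrow> root_refl a b \<in> \<Phi>"
  using root_system unfolding root_system_def by blast

lemma neg_root:
  assumes "b \<in> \<Phi>" shows "- b \<in> \<Phi>"
proof -
  have "b \<noteq> 0" using assms zero_not_root by blast
  then show ?thesis using refl_root[OF assms assms] root_refl_self[OF \<open>b \<noteq> 0\<close>] by simp
qed

lemma simple_root: "k \<in> {1..r} \<Longrightarrow> \<alpha> k \<in> \<Phi>"
  using simple_system unfolding simple_system_def by blast

lemma simple_nonzero: "k \<in> {1..r} \<Longrightarrow> \<alpha> k \<noteq> 0"
  using simple_root[of k] zero_not_root by auto

lemma span_simple: "span (\<alpha> ` {1..r}) = UNIV"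
proof -
  have "\<Phi> \<subseteq> span (\<alpha> ` {1..r})"
  proof
    fix b assume "b \<in> \<Phi>"
    then obtain c :: "nat \<Rightarrow> real" where "b = (\<Sum>i\<in>{1..r}. c i *\<^sub>R \<alpha> i)"
      using simple_system unfolding simple_system_def by meson
    show "b \<in> span (\<alpha> ` {1..r})"
      unfolding \<open>b = _\<close> by (rule span_sum, rule span_scale, rule span_base, rule imageI)
  qed
  then have "span \<Phi> \<subseteq> span (\<alpha> ` {1..r})" by (simp add: span_minimal)
  then show ?thesis using span_roots by auto
qed

lemma blinfun_eq_simple:
  fixes f g :: "'a \<Rightarrow>\<^sub>L real"
  assumes "\<And>k. k \<in> {1..r} \<Longrightarrow> f (\<alpha> k) = g (\<alpha> k)"
  shows "f = g"
proof (rule blinfun_eqI)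
  fix v
  show "f v = g v"
  proof (rule linear_eq_on_span[where B="\<alpha> ` {1..r}"])
    show "linear (blinfun_apply f)" "linear (blinfun_apply g)"
      by (rule bounded_linear.linear[OF blinfun.bounded_linear_right])+
    show "v \<in> span (\<alpha> ` {1..r})" using span_simple by simp
    show "f x = g x" if "x \<in> \<alpha> ` {1..r}" for x using assms that by blast
  qed
qed

text \<open>
  Linear functionals are determined by their values on the simple roots, so the description by
  which the fundamental coweights are defined is satisfied by exactly one functional.
\<close>

lemma coweight_simple:
  assumes "k \<in> {1..r}"
  shows "cw i (\<alpha> k) = (if i = k then 1 else 0)"
proof -
  have ind: "independent (\<alpha> ` {1..r})" and inj: "inj_on \<alpha> {1..r}"
    using simple_system by (auto simp: simple_system_def)
  obtain g :: "'a \<Rightarrow> real" where g: "linear g"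
    "\<forall>x\<in>\<alpha> ` {1..r}. g x = (if inv_into {1..r} \<alpha> x = i then 1 else 0)"
    using linear_independent_extend[OF ind, of "\<lambda>x. if inv_into {1..r} \<alpha> x = i then 1 else 0"]
    by blast
  then have bl: "blinfun_apply (Blinfun g) = g"
    by (simp add: bounded_linear_Blinfun_apply linear_linear)
  have ex: "\<forall>k\<in>{1..r}. blinfun_apply (Blinfun g) (\<alpha> k) = (if i = k then 1 else 0)"
    unfolding bl using g(2) inj by (auto simp: inv_into_f_f)
  have "\<forall>k\<in>{1..r}. blinfun_apply (cw i) (\<alpha> k) = (if i = k then 1 else 0)"
    unfolding coweight_def
    by (rule theI[where a="Blinfun g"]) (use ex in \<open>auto intro: blinfun_eq_simple\<close>)
  then show ?thesis using assms by blast
qed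

lemma simple_expansion: "v = (\<Sum>i\<in>{1..r}. cw i v *\<^sub>R \<alpha> i)"
proof -
  define g where "g = (\<lambda>v. \<Sum>i\<in>{1..r}. cw i v *\<^sub>R \<alpha> i)"
  have "id v = g v"
  proof (rule linear_eq_on_span[where f=id and g=g and B="\<alpha> ` {1..r}"])
    show "linear g"
      unfolding g_def
      by (intro linearI) (simp_all add: blinfun.add_right blinfun.scaleR_right scaleR_add_left
          sum.distrib scaleR_sum_right)
    have "g (\<alpha> k) = \<alpha> k" if "k \<in> {1..r}" for k
      using that by (simp add: g_def coweight_simple if_distrib[where f="\<lambda>x. x *\<^sub>R _"] cong: if_cong)
    then show "id x = g x" if "x \<in> \<alpha> ` {1..r}" for x
      using that by force
    show "v \<in> span (\<alpha> ` {1..r})" using span_simple by simp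
  qed (rule linear_id)
  then show ?thesis by (simp only: g_def id_apply)
qed

lemma blinfun_expansion:
  fixes \<mu> :: "'a \<Rightarrow>\<^sub>L real" shows "\<mu> v = (\<Sum>i\<in>{1..r}. cw i v * \<mu> (\<alpha> i))"
  by (subst simple_expansion[of v]) (simp add: blinfun.sum_right blinfun.scaleR_right)

lemma coweight_sum:
  assumes "j \<in> {1..r}" shows "cw j (\<Sum>i\<in>{1..r}. c i *\<^sub>R \<alpha> i) = c j"
  using assms by (simp add: blinfun.sum_right blinfun.scaleR_right coweight_simple
      if_distrib[where f="\<lambda>x. _ * x"] cong: if_cong)

text \<open>
  The coordinates of \<open>v\<close> in the basis of simple roots are the values \<open>cw i v\<close>; the vector \<open>v\<close>
  is nonnegative when none of them is negative.
\<close>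

definition nonneg :: "'a \<Rightarrow> bool" where
  "nonneg v \<longleftrightarrow> (\<forall>i\<in>{1..r}. 0 \<le> cw i v)"

lemma nonneg_cases: "b \<in> \<Phi> \<Longrightarrow> nonneg b \<or> nonneg (- b)"
proof -
  assume "b \<in> \<Phi>"
  then obtain c :: "nat \<Rightarrow> real" where c: "b = (\<Sum>i\<in>{1..r}. c i *\<^sub>R \<alpha> i)"
     "(\<forall>i\<in>{1..r}. c i \<ge> 0) \<or> (\<forall>i\<in>{1..r}. c i \<le> 0)"
    using simple_system unfolding simple_system_def by meson
  then have "cw i b = c i" if "i \<in> {1..r}" for i
    using coweight_sum that by simp
  then show ?thesis using c(2) by (auto simp: nonneg_def blinfun.minus_right)
qed

lemma nonneg_antisym: "nonneg v \<Longrightarrow> nonneg (- v) \<Longrightarrow> v = 0"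
  by (subst simple_expansion[of v]) (force simp: nonneg_def blinfun.minus_right intro!: sum.neutral)

lemma root_not_both: "b \<in> \<Phi> \<Longrightarrow> nonneg b \<Longrightarrow> \<not> nonneg (- b)"
  using nonneg_antisym zero_not_root by blast

lemma nonneg_simple: "k \<in> {1..r} \<Longrightarrow> nonneg (\<alpha> k)"
  by (auto simp: nonneg_def coweight_simple)

lemma root_nonnegI:
  assumes "b \<in> \<Phi>" "k \<in> {1..r}" "0 < cw k b" shows "nonneg b"
  using nonneg_cases[OF assms(1)] assms(2,3) by (force simp: nonneg_def blinfun.minus_right)

lemma nonneg_linear_image:
  assumes "linear w" "nonneg v"
    and "\<And>k. k \<in> {1..r} \<Longrightarrow> cw k v \<noteq> 0 \<Longrightarrow> nonneg (w (\<alpha> k))"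
  shows "nonneg (w v)"
proof -
  have "w v = (\<Sum>k\<in>{1..r}. cw k v *\<^sub>R w (\<alpha> k))"
    by (subst simple_expansion[of v]) (simp add: linear_sum[OF assms(1)] linear_scale[OF assms(1)])
  moreover have "0 \<le> cw k v * cw i (w (\<alpha> k))" if "k \<in> {1..r}" "i \<in> {1..r}" for i k
    using that assms(2,3) by (cases "cw k v = 0") (auto simp: nonneg_def)
  ultimately show ?thesis
    by (auto simp: nonneg_def blinfun.sum_right blinfun.scaleR_right intro!: sum_nonneg)
qed

lemma coweight_simple_refl:
  assumes "k \<in> {1..r}"
  shows "cw i (\<sigma> k v) = cw i v - (if i = k then 2 * (v \<bullet> \<alpha> k) / (\<alpha> k \<bullet> \<alpha> k) else 0)"
  using assms by (simp add: root_refl_def blinfun.diff_right blinfun.scaleR_right coweight_simple)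

text \<open>A simple reflection makes only one positive root negative.\<close>

lemma simple_refl_nonneg:
  assumes b: "b \<in> \<Phi>" "nonneg b" and k: "k \<in> {1..r}" and "b \<noteq> \<alpha> k"
  shows "nonneg (\<sigma> k b)"
proof -
  (* \<sigma> k changes only the coordinate of index k, so another positive coordinate of b survives. *)
  have "\<exists>j\<in>{1..r}. j \<noteq> k \<and> cw j b \<noteq> 0"
  proof (rule ccontr)
    assume "\<not> ?thesis"
    then have "(\<Sum>i\<in>{1..r}. cw i b *\<^sub>R \<alpha> i) = (\<Sum>i\<in>{k}. cw i b *\<^sub>R \<alpha> i)"
      using k by (intro sum.mono_neutral_right) auto
    then have eq: "b = cw k b *\<^sub>R \<alpha> k" using simple_expansion[of b] by simp
    then have "cw k b = 1 \<or> cw k b = - 1"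
      using reduced simple_root[OF k] b(1) unfolding reduced_roots_def by metis
    moreover have "0 \<le> cw k b" using b(2) k by (auto simp: nonneg_def)
    ultimately have "cw k b = 1" by linarith
    then show False using eq \<open>b \<noteq> \<alpha> k\<close> by simp
  qed
  then obtain j where j: "j \<in> {1..r}" "j \<noteq> k" "cw j b \<noteq> 0" by blast
  then have "0 < cw j (\<sigma> k b)"
    using b(2) coweight_simple_refl[OF k, of j b] by (force simp: nonneg_def)
  then show ?thesis using root_nonnegI refl_root simple_root k b(1) j(1) by blast
qed

text \<open>
  Induction on the height of a positive root: a positive root that is not simple is made lower,
  and stays positive, by some simple reflection.
\<close>

lemma positive_root_induct [consumes 2, case_names simple refl]:
  assumes "b \<in> \<Phi>" "nonneg b"
    and simple: "\<And>k. k \<in> {1..r} \<Longrightarrow> P (\<alpha> k)"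
    and refl: "\<And>k b. k \<in> {1..r} \<Longrightarrow> b \<in> \<Phi> \<Longrightarrow> P b \<Longrightarrow> P (\<sigma> k b)"
  shows "P b"
  using assms(1,2)
proof (induction "card {c\<in>\<Phi>. (\<Sum>i\<in>{1..r}. cw i c) < (\<Sum>i\<in>{1..r}. cw i b)}"
    arbitrary: b rule: less_induct)
  case (less b)
  show ?case
  proof (cases "\<exists>k\<in>{1..r}. b = \<alpha> k")
    case True
    then show ?thesis using simple by blast
  next
    case False
    have "0 < b \<bullet> b" using less.prems(1) zero_not_root by auto
    also have "b \<bullet> b = (\<Sum>i\<in>{1..r}. cw i b * (b \<bullet> \<alpha> i))"
      by (subst (2) simple_expansion[of b]) (simp add: inner_sum_right)
    finally obtain k where k: "k \<in> {1..r}" "0 < cw k b * (b \<bullet> \<alpha> k)"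
      by (meson not_le sum_nonpos)
    then have bk: "0 < b \<bullet> \<alpha> k"
      using less.prems(2) by (force simp: nonneg_def zero_less_mult_iff)
    let ?b = "\<sigma> k b"
    have root: "?b \<in> \<Phi>" using refl_root simple_root k(1) less.prems(1) by blast
    have "nonneg ?b" using simple_refl_nonneg less.prems k(1) False by blast
    have "(\<Sum>i\<in>{1..r}. cw i ?b)
        = (\<Sum>i\<in>{1..r}. cw i b) - 2 * (b \<bullet> \<alpha> k) / (\<alpha> k \<bullet> \<alpha> k)"
      using k(1) by (simp add: coweight_simple_refl sum_subtractf)
    also have "\<dots> < (\<Sum>i\<in>{1..r}. cw i b)"
      using bk simple_nonzero[OF k(1)] by simp
    finally have lower: "(\<Sum>i\<in>{1..r}. cw i ?b) < (\<Sum>i\<in>{1..r}. cw i b)" .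
    have "card {c\<in>\<Phi>. (\<Sum>i\<in>{1..r}. cw i c) < (\<Sum>i\<in>{1..r}. cw i ?b)}
        < card {c\<in>\<Phi>. (\<Sum>i\<in>{1..r}. cw i c) < (\<Sum>i\<in>{1..r}. cw i b)}"
      by (rule psubset_card_mono) (use lower root finite_roots in auto)
    then have "P ?b" using less.hyps root \<open>nonneg ?b\<close> by blast
    then have "P (\<sigma> k ?b)" using refl k(1) root by blast
    then show ?thesis by (simp add: root_refl_involution)
  qed
qed

lemma coweight_root_Ints:
  assumes "b \<in> \<Phi>" shows "cw i b \<in> \<int>"
proof -
  have pos: "cw i b \<in> \<int>" if "b \<in> \<Phi>" "nonneg b" for b
    using that
  proof (induction rule: positive_root_induct)
    case (simple k)
    then show ?case by (simp add: coweight_simple)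
  next
    case (refl k b)
    then have "2 * (b \<bullet> \<alpha> k) / (\<alpha> k \<bullet> \<alpha> k) \<in> \<int>"
      using crystallographic simple_root unfolding crystallographic_def by blast
    then show ?case using refl by (auto simp: coweight_simple_refl)
  qed
  show ?thesis
    using nonneg_cases[OF assms] pos[of b] pos[of "- b"] assms neg_root
    by (auto simp: blinfun.minus_right)
qed

section \<open>The Weyl group\<close>

lemma weyl_linear: "w \<in> W \<Longrightarrow> linear w"
  unfolding weyl_group_def
  by (induction rule: words_induct)
    (auto simp: id_def intro: linear_id[unfolded id_def] linear_compose[unfolded comp_def]
      linear_root_refl linear_compose)

lemma weyl_inner: "w \<in> W \<Longrightarrow> w x \<bullet> w y = x \<bullet> y"
  unfolding weyl_group_def
  by (induction rule: words_induct) (auto simp: root_refl_inner)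

lemma weyl_root: "w \<in> W \<Longrightarrow> b \<in> \<Phi> \<Longrightarrow> w b \<in> \<Phi>"
  unfolding weyl_group_def
  by (induction rule: words_induct) (auto simp: refl_root)

lemma weyl_id: "id \<in> W"
  by (simp add: weyl_group_def words_id)

lemma weyl_comp: "w \<in> W \<Longrightarrow> w' \<in> W \<Longrightarrow> w \<circ> w' \<in> W"
  by (simp add: weyl_group_def words_comp)

lemma weyl_inv:
  assumes "w \<in> W"
  shows "inv w \<in> W" and "inv w (w v) = v" and "w (inv w v) = v"
proof -
  have refls: "s \<circ> s = id" if "s \<in> root_refl ` \<Phi>" for s
    using that by (auto simp: root_refl_involution fun_eq_iff)
  obtain w' where w': "w' \<in> W" "w' \<circ> w = id" "w \<circ> w' = id"
    using words_inverse[OF refls assms[unfolded weyl_group_def]]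
    unfolding weyl_group_def by blast
  have "inv w = w'" using inv_unique_comp[OF w'(3,2)] .
  then show "inv w \<in> W" using w' by simp
  show "inv w (w v) = v"
    using fun_cong[OF w'(2), of v] \<open>inv w = w'\<close> by simp
  show "w (inv w v) = v"
    using fun_cong[OF w'(3), of v] \<open>inv w = w'\<close> by simp
qed

lemma weyl_inv_comp:
  assumes "w \<in> W" "w' \<in> W" shows "inv (w \<circ> w') v = inv w' (inv w v)"
proof -
  have "(w \<circ> w') \<circ> (inv w' \<circ> inv w) = id"
    by (rule ext) (simp add: weyl_inv(3)[OF assms(1)] weyl_inv(3)[OF assms(2)])
  moreover have "(inv w' \<circ> inv w) \<circ> (w \<circ> w') = id"
    by (rule ext) (simp add: weyl_inv(2)[OF assms(1)] weyl_inv(2)[OF assms(2)])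
  ultimately have "inv (w \<circ> w') = inv w' \<circ> inv w" by (rule inv_unique_comp)
  then show ?thesis by simp
qed

text \<open>
  Every positive root arises from a simple one by simple reflections, so its reflection is a
  conjugate of a simple reflection.
\<close>

lemma weyl_simple_generated: "W = words S"
proof
  have S: "s \<circ> s = id" if "s \<in> S" for s
    using that by (auto simp: simple_refls_def root_refl_involution fun_eq_iff)
  show sub: "words S \<subseteq> W"
    unfolding weyl_group_def
    by (rule words_least) (use simple_root in \<open>auto simp: simple_refls_def intro!: words_gen\<close>)
  have conj: "root_refl b \<in> words S" if "b \<in> \<Phi>" "nonneg b" for b
    using that
  proof (induction rule: positive_root_induct)
    case (simple k)
    then show ?case by (auto intro: words_gen simp: simple_refls_def)
  next
    case (refl k b)
    have "root_refl (\<sigma> k b) = \<sigma> k \<circ> root_refl b \<circ> \<sigma> k"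
      using root_refl_conjugate[OF linear_root_refl root_refl_inner, of "\<alpha> k" b]
      by (metis (no_types, lifting) comp_apply ext root_refl_involution)
    moreover have "\<sigma> k \<in> words S"
      using refl by (auto intro: words_gen simp: simple_refls_def)
    ultimately show ?case using refl words_comp by metis
  qed
  have "root_refl (- b) = root_refl b" for b :: 'a
    by (simp add: root_refl_def fun_eq_iff)
  then have "root_refl b \<in> words S" if "b \<in> \<Phi>" for b
    using conj[of b] conj[of "- b"] nonneg_cases[OF that] neg_root[OF that] that by metis
  then show "W \<subseteq> words S"
    unfolding weyl_group_def by (intro words_least) auto
qed

lemma simple_refl_weyl: "k \<in> {1..r} \<Longrightarrow> \<sigma> k \<in> W"
  unfolding weyl_group_def by (rule words_gen, rule imageI, rule simple_root)

lemma finite_weyl: "finite W"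
proof -
  have "inj_on (\<lambda>w. restrict w \<Phi>) W"
  proof (rule inj_onI)
    fix w w' assume w: "w \<in> W" "w' \<in> W" "restrict w \<Phi> = restrict w' \<Phi>"
    have "w x = w' x" if "x \<in> \<Phi>" for x
      using fun_cong[OF w(3), of x] that by simp
    then have "w x = w' x" for x
      using linear_eq_on_span[OF weyl_linear[OF w(1)] weyl_linear[OF w(2)], of \<Phi> x] span_roots
      by simp
    then show "w = w'" by (rule ext)
  qed
  moreover have "(\<lambda>w. restrict w \<Phi>) ` W \<subseteq> \<Phi> \<rightarrow>\<^sub>E \<Phi>"
    using weyl_root by (auto simp: PiE_iff)
  ultimately show ?thesis
    using finite_PiE[OF finite_roots finite_roots] by (rule inj_on_finite)
qed

section \<open>Exchange and longest elements\<close>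

lemma weyl_word: "set xs \<subseteq> S \<Longrightarrow> foldr (\<circ>) xs id \<in> W"
  unfolding weyl_simple_generated by (auto simp: words_def)

text \<open>
  The exchange property: if a word makes \<open>\<alpha> i\<close> negative, multiplying it on the right by \<open>\<sigma> i\<close>
  amounts to deleting one of its letters. The deleted letter is the one at which the image
  of \<open>\<alpha> i\<close> becomes negative.
\<close>

lemma exchange:
  assumes "set xs \<subseteq> S" "i \<in> {1..r}" "nonneg (- foldr (\<circ>) xs id (\<alpha> i))"
  shows "\<exists>ys. set ys \<subseteq> S \<and> length xs = Suc (length ys) \<and>
    foldr (\<circ>) xs id \<circ> \<sigma> i = foldr (\<circ>) ys id"
  using assms(1,3)
proof (induction xs)
  case Nil
  then show ?case
    using root_not_both[OF simple_root nonneg_simple] assms(2) by simp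
next
  case (Cons s xs)
  let ?u = "foldr (\<circ>) xs id"
  obtain j where j: "j \<in> {1..r}" "s = \<sigma> j" using Cons.prems by (auto simp: simple_refls_def)
  have u: "?u \<in> W" using Cons.prems weyl_word by simp
  show ?case
  proof (cases "nonneg (- ?u (\<alpha> i))")
    case True
    then obtain ys where ys: "set ys \<subseteq> S" "length xs = Suc (length ys)"
      "?u \<circ> \<sigma> i = foldr (\<circ>) ys id"
      using Cons.IH Cons.prems(1) by (meson set_subset_Cons subset_trans)
    then have "foldr (\<circ>) (s # xs) id \<circ> \<sigma> i = foldr (\<circ>) (s # ys) id"
      by (metis comp_apply comp_assoc foldr_Cons)
    then show ?thesis
      using Cons.prems(1) ys(1,2)
      by (metis length_Cons list.set(2) insert_subset)
  next
    case False
    have root: "?u (\<alpha> i) \<in> \<Phi>" using u weyl_root simple_root assms(2) by blast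
    then have "nonneg (?u (\<alpha> i))" using False nonneg_cases by blast
    moreover have "foldr (\<circ>) (s # xs) id (\<alpha> i) = \<sigma> j (?u (\<alpha> i))"
      using j(2) by simp
    then have "nonneg (- \<sigma> j (?u (\<alpha> i)))" using Cons.prems(2) by metis
    then have "\<not> nonneg (\<sigma> j (?u (\<alpha> i)))"
      using root_not_both refl_root[OF simple_root[OF j(1)] root] by blast
    (* \<sigma> j turns a positive root negative, so that root is \<alpha> j. *)
    ultimately have "?u (\<alpha> i) = \<alpha> j" using simple_refl_nonneg root j(1) by blast
    then have "\<sigma> j (?u v) = ?u (\<sigma> i v)" for v
      using root_refl_conjugate[OF weyl_linear[OF u] weyl_inner[OF u], of "\<alpha> i" v] by simp
    then have "(\<sigma> j \<circ> ?u) \<circ> \<sigma> i = ?u"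
      by (metis (no_types, lifting) comp_apply ext root_refl_involution)
    then have "foldr (\<circ>) (s # xs) id \<circ> \<sigma> i = ?u"
      using j(2) foldr_comp_append[of "[s]" xs] by simp
    moreover have "set xs \<subseteq> S" using Cons.prems(1) by simp
    ultimately show ?thesis
      by (metis length_Cons)
  qed
qed

lemma weyl_simple_refl_neg:
  assumes "w \<in> W" "k \<in> {1..r}" shows "w (\<sigma> k (\<alpha> k)) = - w (\<alpha> k)"
  using root_refl_self[OF simple_nonzero[OF assms(2)]] linear_neg[OF weyl_linear[OF assms(1)]]
  by simp

text \<open>
  The Weyl group acts freely on simple systems: the last letter of a nonempty shortest word
  for \<open>w\<close> would be a simple reflection whose root \<open>w\<close> makes negative.
\<close>

lemma weyl_trivial:
  assumes w: "w \<in> W" and pos: "\<And>k. k \<in> {1..r} \<Longrightarrow> nonneg (w (\<alpha> k))"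
  shows "w = id"
proof -
  obtain xs where xs: "set xs \<subseteq> S" "length xs = word_length S w" "foldr (\<circ>) xs id = w"
    using word_length_witness w weyl_simple_generated by blast
  show ?thesis
  proof (cases xs rule: rev_cases)
    case Nil
    then show ?thesis using xs by simp
  next
    case (snoc ys s)
    then obtain i where i: "i \<in> {1..r}" "s = \<sigma> i" using xs(1) by (auto simp: simple_refls_def)
    let ?u = "foldr (\<circ>) ys id"
    have ys: "set ys \<subseteq> S" using xs(1) snoc by simp
    have weq: "w = ?u \<circ> \<sigma> i" using xs(3) snoc i(2) foldr_comp_append[of ys "[s]"] by simp
    then have "w (\<alpha> i) = - ?u (\<alpha> i)"
      using weyl_simple_refl_neg[OF weyl_word[OF ys] i(1)] by simp
    then obtain zs where zs: "set zs \<subseteq> S" "length ys = Suc (length zs)" "w = foldr (\<circ>) zs id"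
      using exchange[OF ys i(1)] pos[OF i(1)] weq by auto
    then have "word_length S w \<le> length zs" by (simp add: word_length_le)
    then show ?thesis using xs(2) zs(2) snoc by simp
  qed
qed

lemma word_length_increase:
  assumes w: "w \<in> W" and i: "i \<in> {1..r}" and pos: "nonneg (w (\<alpha> i))"
  shows "word_length S w < word_length S (w \<circ> \<sigma> i)"
proof -
  have "w \<circ> \<sigma> i \<in> words S"
    using w i weyl_comp simple_refl_weyl weyl_simple_generated by auto
  then obtain xs where xs: "set xs \<subseteq> S" "length xs = word_length S (w \<circ> \<sigma> i)"
    "foldr (\<circ>) xs id = w \<circ> \<sigma> i"
    by (rule word_length_witness)
  have "nonneg (- foldr (\<circ>) xs id (\<alpha> i))"
    unfolding xs(3) using weyl_simple_refl_neg[OF w i] pos by simp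
  then obtain ys where ys: "set ys \<subseteq> S" "length xs = Suc (length ys)"
    "foldr (\<circ>) xs id \<circ> \<sigma> i = foldr (\<circ>) ys id"
    using exchange[OF xs(1) i] by blast
  have "foldr (\<circ>) ys id = w"
    using ys(3) xs(3) by (metis (no_types, lifting) comp_apply ext root_refl_involution)
  then have "word_length S w \<le> length ys" using word_length_le ys(1) by blast
  then show ?thesis using ys(2) xs(2) by simp
qed

text \<open>
  If \<open>G\<close> is closed under right multiplication by \<open>\<sigma> k\<close>, a longest element of \<open>G\<close> makes \<open>\<alpha> k\<close>
  negative, since otherwise multiplication by \<open>\<sigma> k\<close> would make it longer. The Weyl group is
  finite, so the maximum defining \<open>longest_in\<close> is attained.
\<close>

lemma longest_in_neg:
  assumes sub: "G \<subseteq> W" and ne: "G \<noteq> {}"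
    and K: "K \<subseteq> {1..r}" and closed: "\<And>g k. g \<in> G \<Longrightarrow> k \<in> K \<Longrightarrow> g \<circ> \<sigma> k \<in> G"
  shows "longest_in r \<alpha> G \<in> G"
    and "k \<in> K \<Longrightarrow> nonneg (- longest_in r \<alpha> G (\<alpha> k))"
proof -
  let ?l = "word_length S"
  have "finite (?l ` G)" using finite_weyl sub by (meson finite_imageI finite_subset)
  then obtain m where m: "\<forall>g. g \<in> G \<longrightarrow> ?l g < m"
    by (meson finite_nat_set_iff_bounded imageI)
  obtain g where g: "g \<in> G" using ne by blast
  show mem: "longest_in r \<alpha> G \<in> G"
    unfolding longest_in_def using arg_max_natI[of "\<lambda>w. w \<in> G", OF g m] .
  have max: "?l g \<le> ?l (longest_in r \<alpha> G)" if "g \<in> G" for g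
    unfolding longest_in_def using arg_max_nat_le[of "\<lambda>w. w \<in> G", OF that m] .
  assume k: "k \<in> K"
  then have "\<not> nonneg (longest_in r \<alpha> G (\<alpha> k))"
    using word_length_increase[of "longest_in r \<alpha> G" k] mem max[OF closed[OF mem k]] sub K
    by (meson in_mono leD)
  then show "nonneg (- longest_in r \<alpha> G (\<alpha> k))"
    using nonneg_cases weyl_root simple_root mem sub K k by (meson in_mono)
qed

abbreviation w0 where "w0 \<equiv> longest_in r \<alpha> W"
abbreviation w0i where "w0i i \<equiv> longest_in r \<alpha> (parabolic r \<alpha> i)"

lemma w0_weyl: "w0 \<in> W" and w0_simple: "k \<in> {1..r} \<Longrightarrow> nonneg (- w0 (\<alpha> k))"
  using longest_in_neg[of W "{1..r}"] weyl_id weyl_comp simple_refl_weyl by blast+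

lemma parabolic_sub: "parabolic r \<alpha> i \<subseteq> W"
  unfolding parabolic_def weyl_simple_generated
  by (rule words_least) (auto simp: simple_refls_def intro!: words_gen)

lemma w0i_parabolic: "w0i i \<in> parabolic r \<alpha> i"
  and w0i_simple: "k \<in> {1..r} - {i} \<Longrightarrow> nonneg (- w0i i (\<alpha> k))"
proof -
  have "parabolic r \<alpha> i \<noteq> {}" using words_id by (auto simp: parabolic_def)
  moreover have "g \<circ> \<sigma> k \<in> parabolic r \<alpha> i" if "g \<in> parabolic r \<alpha> i" "k \<in> {1..r} - {i}" for g k
    using that words_gen[of "\<sigma> k" "simple_refls \<alpha> ({1..r} - {i})"]
    unfolding parabolic_def by (intro words_comp) (auto simp: simple_refls_def)
  ultimately show "w0i i \<in> parabolic r \<alpha> i"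
    "k \<in> {1..r} - {i} \<Longrightarrow> nonneg (- w0i i (\<alpha> k))"
    using longest_in_neg[of "parabolic r \<alpha> i" "{1..r} - {i}"] parabolic_sub by blast+
qed

lemma parabolic_coweight:
  assumes "w \<in> parabolic r \<alpha> i" shows "cw i (w v) = cw i v"
  using assms unfolding parabolic_def
  by (induction rule: words_induct) (auto simp: simple_refls_def coweight_simple_refl split: if_splits)

lemma w0i_weyl: "w0i i \<in> W"
  using w0i_parabolic parabolic_sub by blast

lemma neg_linear_image:
  assumes "linear w" "nonneg v"
    and "\<And>k. k \<in> {1..r} \<Longrightarrow> cw k v \<noteq> 0 \<Longrightarrow> nonneg (- w (\<alpha> k))"
  shows "nonneg (- w v)"
  using nonneg_linear_image[of "\<lambda>v. - w v" v] assms linear_compose_neg by blast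

lemma w0_neg: "nonneg v \<Longrightarrow> nonneg (- w0 v)"
  by (rule neg_linear_image[OF weyl_linear[OF w0_weyl]]) (simp_all add: w0_simple)

lemma w0i_neg:
  assumes "nonneg v" "cw i v = 0" shows "nonneg (- w0i i v)"
  by (rule neg_linear_image[OF weyl_linear[OF w0i_weyl] assms(1)], rule w0i_simple)
    (use assms(2) in auto)

lemma w0_inv_neg:
  assumes "b \<in> \<Phi>" "nonneg b" shows "nonneg (- inv w0 b)"
proof (rule ccontr)
  assume "\<not> ?thesis"
  then have "nonneg (inv w0 b)" using nonneg_cases weyl_root weyl_inv(1) w0_weyl assms(1) by blast
  then have "nonneg (- b)" using w0_neg weyl_inv(3)[OF w0_weyl] by metis
  then show False using root_not_both assms by blast
qed

lemma w0i_inv_coweight: "cw i (inv (w0i i) v) = cw i v"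
  using parabolic_coweight[OF w0i_parabolic, of i "inv (w0i i) v"] weyl_inv(3)[OF w0i_weyl] by simp

lemma w0i_inv_simple:
  assumes k: "k \<in> {1..r}" "k \<noteq> i" shows "nonneg (- inv (w0i i) (\<alpha> k))"
proof (rule ccontr)
  assume "\<not> ?thesis"
  then have "nonneg (inv (w0i i) (\<alpha> k))"
    using nonneg_cases weyl_root weyl_inv(1) w0i_weyl simple_root[OF k(1)] by blast
  moreover have "cw i (inv (w0i i) (\<alpha> k)) = 0"
    using k by (simp add: w0i_inv_coweight coweight_simple)
  ultimately have "nonneg (- \<alpha> k)" using w0i_neg weyl_inv(3)[OF w0i_weyl] by metis
  then show False using root_not_both simple_root nonneg_simple k by blast
qed


section \<open>The extended affine Weyl group\<close>

lemma dual_act_compose: "w \<in> W \<Longrightarrow> dual_act w \<mu> = \<mu> o\<^sub>L Blinfun (inv w)"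
  (is "_ \<Longrightarrow> _ = ?c")
proof -
  assume "w \<in> W"
  then have "bounded_linear (inv w)"
    using weyl_linear[OF weyl_inv(1)] by (simp add: linear_conv_bounded_linear)
  then have "(\<lambda>v. \<mu> (inv w v)) = blinfun_apply ?c"
    by (simp add: fun_eq_iff bounded_linear_Blinfun_apply)
  then show "dual_act w \<mu> = ?c"
    by (simp add: dual_act_def blinfun_apply_inverse)
qed

lemma dual_act_apply:
  assumes "w \<in> W" shows "dual_act w \<mu> v = \<mu> (inv w v)"
  using weyl_linear[OF weyl_inv(1)[OF assms]]
  by (simp add: dual_act_compose[OF assms] linear_conv_bounded_linear bounded_linear_Blinfun_apply)

lemma coweight_lattice_iff:
  "f \<in> coweight_lattice r \<alpha> \<longleftrightarrow> (\<forall>k\<in>{1..r}. f (\<alpha> k) \<in> \<int>)"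
proof
  assume "f \<in> coweight_lattice r \<alpha>"
  then obtain c :: "nat \<Rightarrow> int" where "f = (\<Sum>i\<in>{1..r}. of_int (c i) *\<^sub>R cw i)"
    unfolding coweight_lattice_def by blast
  then show "\<forall>k\<in>{1..r}. f (\<alpha> k) \<in> \<int>"
    by (auto simp: blinfun.sum_left blinfun.scaleR_left coweight_simple intro!: Ints_sum)
next
  assume f: "\<forall>k\<in>{1..r}. f (\<alpha> k) \<in> \<int>"
  have "f = (\<Sum>i\<in>{1..r}. of_int \<lfloor>f (\<alpha> i)\<rfloor> *\<^sub>R cw i)"
  proof (rule blinfun_eq_simple)
    fix k assume k: "k \<in> {1..r}"
    have "(\<Sum>i\<in>{1..r}. of_int \<lfloor>f (\<alpha> i)\<rfloor> *\<^sub>R cw i) (\<alpha> k)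
        = (\<Sum>i\<in>{1..r}. if i = k then of_int \<lfloor>f (\<alpha> i)\<rfloor> else 0)"
      unfolding blinfun.sum_left blinfun.scaleR_left
      by (rule sum.cong) (use k coweight_simple in auto)
    also have "\<dots> = f (\<alpha> k)" using k f by simp
    finally show "f (\<alpha> k) = (\<Sum>i\<in>{1..r}. of_int \<lfloor>f (\<alpha> i)\<rfloor> *\<^sub>R cw i) (\<alpha> k)" by simp
  qed
  then show "f \<in> coweight_lattice r \<alpha>"
    unfolding coweight_lattice_def
    by (intro CollectI exI[of _ "\<lambda>i. \<lfloor>f (\<alpha> i)\<rfloor>"] conjI TrueI)
qed

text \<open>Roots are integer combinations of simple roots, so coweights are integral on all roots.\<close>

lemma coweight_lattice_root:
  assumes "f \<in> coweight_lattice r \<alpha>" "b \<in> \<Phi>" shows "f b \<in> \<int>"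
proof -
  have "cw i b * f (\<alpha> i) \<in> \<int>" if "i \<in> {1..r}" for i
    using assms that coweight_root_Ints coweight_lattice_iff by (intro Ints_mult) auto
  then show ?thesis by (subst blinfun_expansion) (rule Ints_sum)
qed

abbreviation E where "E \<equiv> ext_affine_weyl \<Phi> r \<alpha>"

text \<open>
  The next two lemmas replace the description of the extended affine Weyl group by a pointwise
  one, in terms of the pairing with vectors.
\<close>

lemma ext_affineI:
  fixes v :: "'a \<Rightarrow>\<^sub>L real" and \<phi> :: "('a \<Rightarrow>\<^sub>L real) \<Rightarrow> ('a \<Rightarrow>\<^sub>L real)"
  assumes "w \<in> W" "\<And>k. k \<in> {1..r} \<Longrightarrow> v (\<alpha> k) \<in> \<int>"
    and "\<And>\<mu> b. \<phi> \<mu> b = v b + \<mu> (inv w b)"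
  shows "\<phi> \<in> E"
proof -
  have "\<phi> \<mu> = v + dual_act w \<mu>" for \<mu>
    by (rule blinfun_eqI) (simp add: assms(3) blinfun.add_left dual_act_apply[OF assms(1)])
  then have "\<phi> = (\<lambda>\<mu>. v + dual_act w \<mu>)" by (rule ext)
  moreover have "v \<in> coweight_lattice r \<alpha>" using assms(2) coweight_lattice_iff by blast
  ultimately show ?thesis using assms(1) unfolding ext_affine_weyl_def by blast
qed

lemma ext_affineE:
  fixes \<phi> :: "('a \<Rightarrow>\<^sub>L real) \<Rightarrow> ('a \<Rightarrow>\<^sub>L real)"
  assumes "\<phi> \<in> E"
  obtains w and v :: "'a \<Rightarrow>\<^sub>L real" where "w \<in> W" "\<And>b. b \<in> \<Phi> \<Longrightarrow> v b \<in> \<int>"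
    "\<And>\<mu> b. \<phi> \<mu> b = v b + \<mu> (inv w b)" "\<phi> = (\<lambda>\<mu>. v + dual_act w \<mu>)"
proof -
  obtain v w where vw: "v \<in> coweight_lattice r \<alpha>" "w \<in> W" "\<phi> = (\<lambda>\<mu>. v + dual_act w \<mu>)"
    using assms unfolding ext_affine_weyl_def by blast
  show ?thesis
    by (rule that[of w v])
      (use vw coweight_lattice_root in \<open>auto simp: blinfun.add_left dual_act_apply\<close>)
qed

lemma ext_affine_id: "id \<in> E"
  by (rule ext_affineI[of id 0]) (simp_all add: weyl_id)

lemma ext_affine_comp:
  assumes "\<phi> \<in> E" "\<psi> \<in> E" shows "\<phi> \<circ> \<psi> \<in> E"
proof -
  obtain w and v :: "'a \<Rightarrow>\<^sub>L real" where \<phi>: "w \<in> W"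
    "\<And>b. b \<in> \<Phi> \<Longrightarrow> v b \<in> \<int>" "\<And>\<mu> b. \<phi> \<mu> b = v b + \<mu> (inv w b)"
    using ext_affineE[OF assms(1)] by metis
  obtain w' and v' :: "'a \<Rightarrow>\<^sub>L real" where \<psi>: "w' \<in> W" "\<And>b. b \<in> \<Phi> \<Longrightarrow> v' b \<in> \<int>"
    "\<And>\<mu> b. \<psi> \<mu> b = v' b + \<mu> (inv w' b)"
    using ext_affineE[OF assms(2)] by metis
  show ?thesis
  proof (rule ext_affineI[of "w \<circ> w'" "v + dual_act w v'"])
    show "w \<circ> w' \<in> W" using weyl_comp \<phi>(1) \<psi>(1) .
    show "(v + dual_act w v') (\<alpha> k) \<in> \<int>" if "k \<in> {1..r}" for k
      using \<phi>(2) \<psi>(2) simple_root[OF that] weyl_root[OF weyl_inv(1)[OF \<phi>(1)]]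
      by (simp add: blinfun.add_left dual_act_apply[OF \<phi>(1)])
    show "(\<phi> \<circ> \<psi>) \<mu> b = (v + dual_act w v') b + \<mu> (inv (w \<circ> w') b)" for \<mu> b
      by (simp add: blinfun.add_left dual_act_apply[OF \<phi>(1)] \<phi>(3) \<psi>(3)
          weyl_inv_comp[OF \<phi>(1) \<psi>(1)])
  qed
qed

lemma ext_affine_inverse:
  assumes "\<phi> \<in> E" shows "\<exists>\<psi>\<in>E. \<psi> \<circ> \<phi> = id \<and> \<phi> \<circ> \<psi> = id"
proof -
  obtain w and v :: "'a \<Rightarrow>\<^sub>L real" where \<phi>: "w \<in> W"
    "\<And>b. b \<in> \<Phi> \<Longrightarrow> v b \<in> \<int>" "\<And>\<mu> b. \<phi> \<mu> b = v b + \<mu> (inv w b)"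
    using ext_affineE[OF assms] by metis
  note iw = weyl_inv(1)[OF \<phi>(1)]
  have inv: "inv (inv w) b = w b" for b
    using weyl_inv(3)[OF iw, of b] weyl_inv(3)[OF \<phi>(1), of "inv (inv w) b"] by simp
  define v' where "v' = - dual_act (inv w) v"
  define \<psi> where "\<psi> = (\<lambda>\<mu>. v' + dual_act (inv w) \<mu>)"
  have \<psi>: "\<psi> \<mu> b = \<mu> (w b) - v (w b)" for \<mu> b
    by (simp add: \<psi>_def v'_def blinfun.diff_left dual_act_apply[OF iw] inv)
  have "\<psi> \<in> E"
  proof (rule ext_affineI[of "inv w" v', OF iw])
    show "v' (\<alpha> k) \<in> \<int>" if "k \<in> {1..r}" for k
      using \<phi>(2) weyl_root[OF \<phi>(1) simple_root[OF that]]
      by (simp add: v'_def blinfun.minus_left dual_act_apply[OF iw] inv)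
    show "\<psi> \<mu> b = v' b + \<mu> (inv (inv w) b)" for \<mu> b
      by (simp add: \<psi>_def blinfun.add_left dual_act_apply[OF iw])
  qed
  moreover have "\<psi> (\<phi> \<mu>) = \<mu>" "\<phi> (\<psi> \<mu>) = \<mu>" for \<mu>
    by (auto intro!: blinfun_eqI simp: \<psi> \<phi>(3) weyl_inv(2,3)[OF \<phi>(1)])
  ultimately show ?thesis by (auto simp: fun_eq_iff)
qed

lemma ext_affine_continuous:
  assumes "\<phi> \<in> E" shows "continuous_on A \<phi>"
proof -
  obtain w v where "w \<in> W" "\<phi> = (\<lambda>\<mu>. v + dual_act w \<mu>)"
    using ext_affineE[OF assms] by metis
  then show ?thesis by (simp add: dual_act_compose) (intro continuous_intros)
qed

end

section \<open>The fundamental alcove and its stabilizer\<close>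

text \<open>A based root system with a highest root \<open>\<theta>\<close>.\<close>

locale based_root_system_highest = based_root_system +
  fixes \<theta> :: 'a
  assumes highest_root: "highest_root \<Phi> r \<alpha> \<theta>"
begin

abbreviation A where "A \<equiv> alcove r \<alpha> \<theta>"
abbreviation \<Omega> where "\<Omega> \<equiv> alcove_stab \<Phi> r \<alpha> \<theta>"
abbreviation \<omega> where "\<omega> \<equiv> omega \<Phi> r \<alpha>"

text \<open>The indices of the simple roots that occur in the highest root with coefficient \<open>1\<close>.\<close>

definition J where "J = {i \<in> {1..r}. cw i \<theta> = 1}"

text \<open>
  The open alcove is given by strict versions of the inequalities of the alcove. It contains the
  interior of the alcove (and equals it), but is more convenient to compute with.
\<close>

definition open_alcove :: "('a \<Rightarrow>\<^sub>L real) set" where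
  "open_alcove = {\<mu> :: 'a \<Rightarrow>\<^sub>L real. (\<forall>k\<in>{1..r}. 0 < \<mu> (\<alpha> k)) \<and> \<mu> \<theta> < 1}"

lemma highest_root_in: "\<theta> \<in> \<Phi>"
  using highest_root by (simp add: highest_root_def)

lemma highest_root_max:
  assumes "b \<in> \<Phi>" shows "nonneg (\<theta> - b)"
proof -
  obtain c :: "nat \<Rightarrow> real" where c: "\<forall>i\<in>{1..r}. c i \<ge> 0"
    "\<theta> - b = (\<Sum>i\<in>{1..r}. c i *\<^sub>R \<alpha> i)"
    using highest_root assms unfolding highest_root_def by blast
  show ?thesis unfolding nonneg_def c(2) using c(1) coweight_sum[of _ c] by simp
qed

lemma coweight_highest_root_ge: "i \<in> {1..r} \<Longrightarrow> 1 \<le> cw i \<theta>"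
  using highest_root_max[OF simple_root, of i]
  by (auto simp: nonneg_def blinfun.diff_right coweight_simple dest: bspec[of _ _ i])

lemma nonneg_highest_root: "nonneg \<theta>"
  unfolding nonneg_def using coweight_highest_root_ge by force

lemma alcove_nonneg:
  fixes \<mu> :: "'a \<Rightarrow>\<^sub>L real"
  assumes "\<mu> \<in> A" "nonneg v" shows "0 \<le> \<mu> v"
  using assms by (subst blinfun_expansion) (auto simp: alcove_def nonneg_def intro!: sum_nonneg)

lemma alcove_le_1:
  fixes \<mu> :: "'a \<Rightarrow>\<^sub>L real"
  assumes "\<mu> \<in> A" "b \<in> \<Phi>" shows "\<mu> b \<le> 1"
  using alcove_nonneg[OF assms(1) highest_root_max[OF assms(2)]] assms(1)
  by (simp add: alcove_def blinfun.diff_right)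

lemma open_alcove_sub: "open_alcove \<subseteq> A"
  by (auto simp: open_alcove_def alcove_def intro: less_imp_le)

lemma open_alcove_pos:
  fixes \<mu> :: "'a \<Rightarrow>\<^sub>L real"
  assumes "\<mu> \<in> open_alcove" "b \<in> \<Phi>" "nonneg b" shows "0 < \<mu> b"
proof -
  have "b \<noteq> 0" using assms(2) zero_not_root by blast
  then obtain j where j: "j \<in> {1..r}" "cw j b \<noteq> 0"
    using simple_expansion[of b] by (metis (no_types, lifting) scaleR_zero_left sum.neutral)
  have pos: "0 < \<mu> (\<alpha> i)" "0 \<le> cw i b" if "i \<in> {1..r}" for i
    using assms(1,3) that by (simp_all add: open_alcove_def nonneg_def)
  have "0 < (\<Sum>i\<in>{1..r}. cw i b * \<mu> (\<alpha> i))"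
  proof (rule sum_pos2)
    show "0 < cw j b * \<mu> (\<alpha> j)" using pos[OF j(1)] j(2) by simp
    show "0 \<le> cw i b * \<mu> (\<alpha> i)" if "i \<in> {1..r}" for i
      using pos[OF that] by simp
  qed (use j in auto)
  then show ?thesis using blinfun_expansion[of \<mu> b] by simp
qed

lemma open_alcove_less_1:
  fixes \<mu> :: "'a \<Rightarrow>\<^sub>L real"
  assumes "\<mu> \<in> open_alcove" "b \<in> \<Phi>" shows "\<mu> b < 1"
proof -
  have "0 \<le> \<mu> (\<theta> - b)"
    using alcove_nonneg highest_root_max assms open_alcove_sub by blast
  then show ?thesis using assms(1) by (simp add: open_alcove_def blinfun.diff_right)
qed

lemma open_alcove_nonempty: "\<exists>\<mu>. \<mu> \<in> open_alcove"
proof -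
  define N where "N = (\<Sum>k\<in>{1..r}. cw k \<theta>)"
  have N: "0 \<le> N" unfolding N_def using nonneg_highest_root by (auto simp: nonneg_def intro: sum_nonneg)
  define \<mu> where "\<mu> = (1 / (1 + N)) *\<^sub>R (\<Sum>i\<in>{1..r}. cw i)"
  have "\<mu> (\<alpha> k) = 1 / (1 + N)" if "k \<in> {1..r}" for k
    using that by (simp add: \<mu>_def blinfun.scaleR_left blinfun.sum_left coweight_simple)
  moreover have "\<mu> \<theta> = N / (1 + N)"
    by (simp add: \<mu>_def N_def blinfun.scaleR_left blinfun.sum_left)
  ultimately have "\<mu> \<in> open_alcove" using N by (simp add: open_alcove_def)
  then show ?thesis by blast
qed

text \<open>
  A root takes values in \<open>(0, 1)\<close> or in \<open>(-1, 0)\<close> on the open alcove, so an affine function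
  with a root as linear part and an integer constant has constant sign there.
\<close>

lemma affine_root_sign:
  fixes \<mu> \<nu> :: "'a \<Rightarrow>\<^sub>L real"
  assumes "c \<in> \<Phi>" "m \<in> \<int>" "\<nu> \<in> open_alcove" "0 < m + \<nu> c" "\<mu> \<in> A"
  shows "0 \<le> m + \<mu> c"
proof -
  obtain z where z: "m = of_int z" using assms(2) by (auto elim: Ints_cases)
  show ?thesis
  proof (cases "nonneg c")
    case True
    have "- 1 < m" using open_alcove_less_1[OF assms(3,1)] assms(4) by linarith
    then have "- 1 < z" unfolding z using of_int_less_iff[of "- 1" z] by simp
    then have "0 \<le> m" unfolding z by simp
    then show ?thesis using alcove_nonneg[OF assms(5) True] by simp
  next
    case False
    then have neg: "- c \<in> \<Phi>" "nonneg (- c)" using neg_root nonneg_cases assms(1) by blast+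
    have "0 < m"
      using open_alcove_pos[OF assms(3) neg] assms(4) by (simp add: blinfun.minus_right)
    then have "1 \<le> m" unfolding z by simp
    then show ?thesis using alcove_le_1[OF assms(5) neg(1)] by (simp add: blinfun.minus_right)
  qed
qed

lemma ext_affine_alcove_sub:
  fixes \<nu> :: "'a \<Rightarrow>\<^sub>L real" and \<phi> :: "('a \<Rightarrow>\<^sub>L real) \<Rightarrow> ('a \<Rightarrow>\<^sub>L real)"
  assumes \<phi>: "\<phi> \<in> E" and \<nu>: "\<nu> \<in> open_alcove" "\<phi> \<nu> \<in> open_alcove"
  shows "\<phi> ` A \<subseteq> A"
proof
  fix x assume "x \<in> \<phi> ` A"
  then obtain \<mu> where \<mu>: "\<mu> \<in> A" "x = \<phi> \<mu>" by blast
  obtain w and v :: "'a \<Rightarrow>\<^sub>L real" where w: "w \<in> W"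
    "\<And>b. b \<in> \<Phi> \<Longrightarrow> v b \<in> \<int>" "\<And>\<mu> b. \<phi> \<mu> b = v b + \<mu> (inv w b)"
    using ext_affineE[OF \<phi>] by metis
  have root: "inv w b \<in> \<Phi>" if "b \<in> \<Phi>" for b
    using weyl_root[OF weyl_inv(1)[OF w(1)] that] .
  have "0 \<le> \<phi> \<mu> (\<alpha> k)" if k: "k \<in> {1..r}" for k
    unfolding w(3)
    by (rule affine_root_sign[OF root[OF simple_root[OF k]] w(2)[OF simple_root[OF k]] \<nu>(1) _ \<mu>(1)])
      (use \<nu>(2) k w(3)[of \<nu>] in \<open>auto simp: open_alcove_def\<close>)
  moreover have "0 \<le> (1 - v \<theta>) + \<mu> (- inv w \<theta>)"
    by (rule affine_root_sign[OF neg_root[OF root[OF highest_root_in]] _ \<nu>(1) _ \<mu>(1)])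
      (use \<nu>(2) w(2)[OF highest_root_in] w(3)[of \<nu>] in
        \<open>auto simp: open_alcove_def blinfun.minus_right\<close>)
  then have "\<phi> \<mu> \<theta> \<le> 1" unfolding w(3) by (simp add: blinfun.minus_right)
  ultimately show "x \<in> A" using \<mu>(2) by (simp add: alcove_def)
qed

text \<open>
  The values of the roots at the image of a point of the open alcove are never integers, so the
  image lies on no wall.
\<close>

lemma ext_affine_open_alcove:
  fixes \<nu> :: "'a \<Rightarrow>\<^sub>L real" and \<phi> :: "('a \<Rightarrow>\<^sub>L real) \<Rightarrow> ('a \<Rightarrow>\<^sub>L real)"
  assumes \<phi>: "\<phi> \<in> E" and \<nu>: "\<nu> \<in> open_alcove" "\<phi> \<nu> \<in> A"
  shows "\<phi> \<nu> \<in> open_alcove"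
proof -
  obtain w and v :: "'a \<Rightarrow>\<^sub>L real" where w: "w \<in> W"
    "\<And>b. b \<in> \<Phi> \<Longrightarrow> v b \<in> \<int>" "\<And>\<mu> b. \<phi> \<mu> b = v b + \<mu> (inv w b)"
    using ext_affineE[OF \<phi>] by metis
  have non_int: "\<phi> \<nu> b \<notin> \<int>" if "b \<in> \<Phi>" for b
  proof
    assume "\<phi> \<nu> b \<in> \<int>"
    then have "\<nu> (inv w b) \<in> \<int>"
      using w(2)[OF that] w(3)[of \<nu> b] by (metis Ints_diff add_diff_cancel_left')
    then obtain z where z: "\<nu> (inv w b) = of_int z" by (auto elim: Ints_cases)
    have root: "inv w b \<in> \<Phi>" using weyl_root[OF weyl_inv(1)[OF w(1)] that] .
    have "\<nu> (inv w b) < 1" "\<nu> (- inv w b) < 1"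
      using open_alcove_less_1[OF \<nu>(1)] root neg_root by blast+
    then have "z = 0" using z by (simp add: blinfun.minus_right)
    then have "\<nu> (inv w b) = 0" "\<nu> (- inv w b) = 0"
      using z by (simp_all add: blinfun.minus_right)
    then show False
      using nonneg_cases[OF root] open_alcove_pos[OF \<nu>(1)] root neg_root by fastforce
  qed
  have "0 < \<phi> \<nu> (\<alpha> k)" if "k \<in> {1..r}" for k
  proof -
    have "\<phi> \<nu> (\<alpha> k) \<noteq> 0" using non_int[OF simple_root[OF that]] by auto
    moreover have "0 \<le> \<phi> \<nu> (\<alpha> k)" using \<nu>(2) that by (simp add: alcove_def)
    ultimately show ?thesis by simp
  qed
  moreover have "\<phi> \<nu> \<theta> < 1"
  proof -
    have "\<phi> \<nu> \<theta> \<noteq> 1" using non_int[OF highest_root_in] by auto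
    moreover have "\<phi> \<nu> \<theta> \<le> 1" using \<nu>(2) by (simp add: alcove_def)
    ultimately show ?thesis by simp
  qed
  ultimately show ?thesis by (simp add: open_alcove_def)
qed

text \<open>
  One point of the open alcove that is mapped into the alcove forces the whole alcove to be
  mapped onto itself: the previous lemmas apply to the inverse map as well.
\<close>

lemma ext_affine_stab:
  fixes \<nu> :: "'a \<Rightarrow>\<^sub>L real" and \<phi> :: "('a \<Rightarrow>\<^sub>L real) \<Rightarrow> ('a \<Rightarrow>\<^sub>L real)"
  assumes \<phi>: "\<phi> \<in> E" and \<nu>: "\<nu> \<in> open_alcove" "\<phi> \<nu> \<in> A"
  shows "\<phi> \<in> \<Omega>"
proof -
  have op: "\<phi> \<nu> \<in> open_alcove" using ext_affine_open_alcove[OF assms] .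
  obtain \<psi> where \<psi>: "\<psi> \<in> E" "\<psi> \<circ> \<phi> = id" "\<phi> \<circ> \<psi> = id"
    using ext_affine_inverse[OF \<phi>] by blast
  have "\<psi> (\<phi> \<nu>) = \<nu>" using \<psi>(2) by (metis comp_apply id_apply)
  then have "\<psi> ` A \<subseteq> A" using ext_affine_alcove_sub[OF \<psi>(1) op] \<nu>(1) by simp
  then have "A \<subseteq> \<phi> ` A" using \<psi>(3) by (metis image_comp image_id image_mono id_apply)
  then show ?thesis
    using ext_affine_alcove_sub[OF \<phi> \<nu>(1) op] \<phi> by (auto simp: alcove_stab_def)
qed

lemma stab_id: "id \<in> \<Omega>"
  using ext_affine_id by (simp add: alcove_stab_def)

lemma stab_comp: "\<phi> \<in> \<Omega> \<Longrightarrow> \<psi> \<in> \<Omega> \<Longrightarrow> \<phi> \<circ> \<psi> \<in> \<Omega>"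
  unfolding alcove_stab_def mem_Collect_eq image_comp[symmetric] using ext_affine_comp by auto

lemma stab_ext: "\<phi> \<in> \<Omega> \<Longrightarrow> \<phi> \<in> E"
  by (simp add: alcove_stab_def)

lemma stab_alcove: "\<phi> \<in> \<Omega> \<Longrightarrow> \<mu> \<in> A \<Longrightarrow> \<phi> \<mu> \<in> A"
  by (auto simp: alcove_stab_def)

lemma stab_inverse:
  assumes "\<phi> \<in> \<Omega>" shows "\<exists>\<psi>\<in>\<Omega>. \<psi> \<circ> \<phi> = id \<and> \<phi> \<circ> \<psi> = id"
proof -
  obtain \<psi> where \<psi>: "\<psi> \<in> E" "\<psi> \<circ> \<phi> = id" "\<phi> \<circ> \<psi> = id"
    using ext_affine_inverse[OF stab_ext[OF assms]] by blast
  have "\<psi> ` A = \<psi> ` \<phi> ` A" using assms by (simp add: alcove_stab_def)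
  also have "\<dots> = A" using \<psi>(2) by (simp add: image_comp)
  finally show ?thesis using \<psi> by (auto simp: alcove_stab_def)
qed

lemma zero_alcove: "0 \<in> A"
  by (simp add: alcove_def)

text \<open>
  An element of the stabilizer that fixes \<open>0\<close> is given by an element of the Weyl group; it
  preserves the alcove, hence makes no simple root negative, and is the identity.
\<close>

lemma stab_unique:
  assumes \<phi>: "\<phi> \<in> \<Omega>" and \<psi>: "\<psi> \<in> \<Omega>" and eq: "\<phi> 0 = \<psi> 0"
  shows "\<phi> = \<psi>"
proof -
  obtain \<xi> where \<xi>: "\<xi> \<in> \<Omega>" "\<xi> \<circ> \<psi> = id" "\<psi> \<circ> \<xi> = id"
    using stab_inverse[OF \<psi>] by blast
  have st: "\<xi> \<circ> \<phi> \<in> \<Omega>" using stab_comp \<xi>(1) \<phi> by blast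
  obtain w and v :: "'a \<Rightarrow>\<^sub>L real" where w: "w \<in> W"
    "\<And>\<mu> b. (\<xi> \<circ> \<phi>) \<mu> b = v b + \<mu> (inv w b)"
    using ext_affineE[OF stab_ext[OF st]] by metis
  have "(\<xi> \<circ> \<phi>) 0 = 0" using eq \<xi>(2) by (metis comp_apply id_apply)
  then have v: "v b = 0" for b using w(2)[of 0 b] by simp
  obtain \<nu> where \<nu>: "\<nu> \<in> open_alcove" using open_alcove_nonempty by blast
  have "nonneg (inv w (\<alpha> k))" if k: "k \<in> {1..r}" for k
  proof (rule ccontr)
    assume neg: "\<not> ?thesis"
    have root: "inv w (\<alpha> k) \<in> \<Phi>" using weyl_root[OF weyl_inv(1)[OF w(1)] simple_root[OF k]] .
    have "0 < \<nu> (- inv w (\<alpha> k))"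
      using open_alcove_pos[OF \<nu> neg_root[OF root]] nonneg_cases[OF root] neg by blast
    moreover have "0 \<le> (\<xi> \<circ> \<phi>) \<nu> (\<alpha> k)"
      using stab_alcove[OF st] \<nu> open_alcove_sub k by (auto simp: alcove_def)
    ultimately show False using w(2)[of \<nu> "\<alpha> k"] v by (simp add: blinfun.minus_right)
  qed
  then have "inv w = id" using weyl_trivial[OF weyl_inv(1)[OF w(1)]] by blast
  then have "(\<xi> \<circ> \<phi>) \<mu> = \<mu>" for \<mu>
    by (intro blinfun_eqI) (simp only: w(2) v, simp)
  then have "\<xi> (\<phi> \<mu>) = \<mu>" for \<mu> by simp
  moreover have "\<psi> (\<xi> (\<phi> \<mu>)) = \<phi> \<mu>" for \<mu>
    using fun_cong[OF \<xi>(3), of "\<phi> \<mu>"] by simp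
  ultimately show "\<phi> = \<psi>" by (simp add: fun_eq_iff)
qed

text \<open>
  The image of \<open>0\<close> under an element of the stabilizer is a point of the coweight lattice in the
  alcove; the only such points are \<open>0\<close> and the fundamental coweights of index in \<open>J\<close>.
\<close>

lemma stab_zero:
  assumes "\<phi> \<in> \<Omega>" shows "\<phi> 0 = 0 \<or> (\<exists>i\<in>J. \<phi> 0 = cw i)"
proof -
  let ?v = "\<phi> 0"
  have v: "?v \<in> A" using stab_alcove[OF assms zero_alcove] .
  obtain w and v :: "'a \<Rightarrow>\<^sub>L real" where w: "\<And>b. b \<in> \<Phi> \<Longrightarrow> v b \<in> \<int>"
    "\<And>\<mu> b. \<phi> \<mu> b = v b + \<mu> (inv w b)"
    using ext_affineE[OF stab_ext[OF assms]] by metis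
  have int: "?v (\<alpha> k) \<in> \<int>" if "k \<in> {1..r}" for k
    using w(1)[OF simple_root[OF that]] w(2)[of 0] by simp
  have pos: "0 \<le> ?v (\<alpha> k)" if "k \<in> {1..r}" for k
    using v that by (simp add: alcove_def)
  show ?thesis
  proof (cases "\<exists>i\<in>{1..r}. ?v (\<alpha> i) \<noteq> 0")
    case False
    then have "?v = 0" by (intro blinfun_eq_simple) auto
    then show ?thesis by blast
  next
    case True
    then obtain i where i: "i \<in> {1..r}" "?v (\<alpha> i) \<noteq> 0" by blast
    obtain z where z: "?v (\<alpha> i) = of_int z" using int[OF i(1)] by (auto elim: Ints_cases)
    then have vi: "1 \<le> ?v (\<alpha> i)" using pos[OF i(1)] i(2) by simp
    have ni: "1 \<le> cw i \<theta>" using coweight_highest_root_ge[OF i(1)] .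
    define R where "R = (\<Sum>k\<in>{1..r} - {i}. cw k \<theta> * ?v (\<alpha> k))"
    have nonneg: "0 \<le> cw k \<theta> * ?v (\<alpha> k)" if "k \<in> {1..r}" for k
      using pos[OF that] nonneg_highest_root that by (simp add: nonneg_def)
    have R: "0 \<le> R" unfolding R_def by (rule sum_nonneg) (use nonneg in auto)
    have "?v \<theta> = cw i \<theta> * ?v (\<alpha> i) + R"
      unfolding R_def using i(1) by (subst blinfun_expansion) (simp add: sum.remove)
    moreover have "?v \<theta> \<le> 1" using v by (simp add: alcove_def)
    moreover have "cw i \<theta> \<le> cw i \<theta> * ?v (\<alpha> i)" "?v (\<alpha> i) \<le> cw i \<theta> * ?v (\<alpha> i)"
      using vi ni by (simp_all add: mult_le_cancel_left1 mult_le_cancel_right1)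
    ultimately have one: "cw i \<theta> = 1" "?v (\<alpha> i) = 1" "R = 0" using R vi ni by linarith+
    have "?v (\<alpha> k) = 0" if "k \<in> {1..r}" "k \<noteq> i" for k
    proof -
      have "cw k \<theta> * ?v (\<alpha> k) = 0"
        using one(3) nonneg that unfolding R_def by (subst (asm) sum_nonneg_eq_0_iff) auto
      then show ?thesis using coweight_highest_root_ge[OF that(1)] by auto
    qed
    then have "?v = cw i"
      using one(2) by (intro blinfun_eq_simple) (auto simp: coweight_simple)
    then show ?thesis using i(1) one(1) by (auto simp: J_def)
  qed
qed

text \<open>
  By maximality of \<open>\<theta>\<close> both \<open>\<theta> + inv w0 \<theta>\<close> and \<open>\<theta> + w0 \<theta>\<close> are nonnegative; \<open>w0\<close> maps the former
  to the latter and reverses signs, so both vanish.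
\<close>

lemma w0_inv_highest: "inv w0 \<theta> = - \<theta>"
proof -
  have root: "inv w0 \<theta> \<in> \<Phi>" "w0 \<theta> \<in> \<Phi>"
    using weyl_root highest_root_in w0_weyl weyl_inv(1) by blast+
  have "nonneg (\<theta> + inv w0 \<theta>)" using highest_root_max[OF neg_root[OF root(1)]] by simp
  then have "nonneg (- w0 (\<theta> + inv w0 \<theta>))" by (rule w0_neg)
  then have "nonneg (- (\<theta> + w0 \<theta>))"
    by (simp add: linear_add[OF weyl_linear[OF w0_weyl]] weyl_inv(3)[OF w0_weyl] add.commute)
  moreover have "nonneg (\<theta> + w0 \<theta>)" using highest_root_max[OF neg_root[OF root(2)]] by simp
  ultimately have "\<theta> + w0 \<theta> = 0" using nonneg_antisym by blast
  then have "\<theta> = - w0 \<theta>" by (simp add: eq_neg_iff_add_eq_0)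
  then have "inv w0 \<theta> = - inv w0 (w0 \<theta>)"
    using linear_neg[OF weyl_linear[OF weyl_inv(1)[OF w0_weyl]]] by metis
  then show ?thesis by (simp add: weyl_inv(2)[OF w0_weyl])
qed

text \<open>
  The same argument for the parabolic subgroup of index \<open>i\<close>: the difference of \<open>\<theta>\<close> and the
  preimage of \<open>\<alpha> i\<close> has coordinate \<open>0\<close> at \<open>i\<close> exactly because \<open>i \<in> J\<close>, so its sign is reversed.
\<close>

lemma w0i_inv_simple_special:
  assumes i: "i \<in> J" shows "inv (w0i i) (\<alpha> i) = \<theta>"
proof -
  have i': "i \<in> {1..r}" "cw i \<theta> = 1" using i by (auto simp: J_def)
  let ?b = "inv (w0i i) (\<alpha> i)"
  have root: "?b \<in> \<Phi>" "w0i i \<theta> \<in> \<Phi>"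
    using weyl_root highest_root_in w0i_weyl weyl_inv(1) simple_root[OF i'(1)] by blast+
  have "cw i (\<theta> - ?b) = 0"
    using i' by (simp add: blinfun.diff_right w0i_inv_coweight coweight_simple)
  then have "nonneg (- w0i i (\<theta> - ?b))" using w0i_neg highest_root_max[OF root(1)] by blast
  then have le: "nonneg (\<alpha> i - w0i i \<theta>)"
    by (simp add: linear_diff[OF weyl_linear[OF w0i_weyl]] weyl_inv(3)[OF w0i_weyl])
  have c: "cw i (w0i i \<theta>) = 1" using parabolic_coweight[OF w0i_parabolic] i' by simp
  then have "nonneg (w0i i \<theta>)" using root_nonnegI[OF root(2) i'(1)] by simp
  then have "nonneg (- (\<alpha> i - w0i i \<theta>))"
    using c i'(1) by (auto simp: nonneg_def blinfun.diff_right blinfun.minus_right coweight_simple)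
  then have "\<alpha> i = w0i i \<theta>" using nonneg_antisym[OF le] by simp
  then show ?thesis using weyl_inv(2)[OF w0i_weyl] by simp
qed

lemma omega_apply: "\<omega> i \<mu> b = cw i b + \<mu> (inv w0 (inv (w0i i) b))"
  unfolding omega_def blinfun.add_left dual_act_apply[OF weyl_comp[OF w0i_weyl w0_weyl]]
    weyl_inv_comp[OF w0i_weyl w0_weyl] ..

text \<open>The element \<open>\<omega> i\<close> carries the wall of the highest root to the wall of \<open>\<alpha> i\<close>.\<close>

lemma omega_special:
  assumes "i \<in> J" shows "\<omega> i \<mu> (\<alpha> i) = 1 - \<mu> \<theta>"
  using assms by (simp add: omega_apply coweight_simple J_def w0i_inv_simple_special[OF assms]
      w0_inv_highest blinfun.minus_right)

lemma omega_zero: "\<omega> i 0 = cw i"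
  by (rule blinfun_eqI) (simp add: omega_apply)

text \<open>It suffices that \<open>\<omega> i\<close> maps one point of the open alcove into the alcove.\<close>

lemma omega_stab:
  assumes i: "i \<in> J" shows "\<omega> i \<in> \<Omega>"
proof -
  have i': "i \<in> {1..r}" "cw i \<theta> = 1" using i by (auto simp: J_def)
  have E: "\<omega> i \<in> E"
  proof (rule ext_affineI)
    show "w0i i \<circ> w0 \<in> W" using weyl_comp[OF w0i_weyl w0_weyl] .
    show "cw i (\<alpha> k) \<in> \<int>" if "k \<in> {1..r}" for k using that by (simp add: coweight_simple)
    show "\<omega> i \<mu> b = cw i b + \<mu> (inv (w0i i \<circ> w0) b)" for \<mu> b
      by (simp only: omega_apply weyl_inv_comp[OF w0i_weyl w0_weyl])
  qed
  obtain \<nu> where \<nu>: "\<nu> \<in> open_alcove" using open_alcove_nonempty by blast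
  then have \<nu>A: "\<nu> \<in> A" using open_alcove_sub by blast
  have root: "inv (w0i i) b \<in> \<Phi>" if "b \<in> \<Phi>" for b
    using weyl_root[OF weyl_inv(1)[OF w0i_weyl] that] .
  have "0 \<le> \<omega> i \<nu> (\<alpha> k)" if k: "k \<in> {1..r}" for k
  proof (cases "k = i")
    case True
    then show ?thesis using omega_special[OF i] \<nu>A by (simp add: alcove_def)
  next
    case False
    have "nonneg (- inv w0 (- inv (w0i i) (\<alpha> k)))"
      using w0_inv_neg[OF neg_root[OF root[OF simple_root[OF k]]] w0i_inv_simple[OF k False]] .
    then have "nonneg (inv w0 (inv (w0i i) (\<alpha> k)))"
      by (simp add: linear_neg[OF weyl_linear[OF weyl_inv(1)[OF w0_weyl]]])
    then show ?thesis
      using alcove_nonneg[OF \<nu>A] k False by (simp add: omega_apply coweight_simple)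
  qed
  moreover have "\<omega> i \<nu> \<theta> \<le> 1"
  proof -
    have "nonneg (inv (w0i i) \<theta>)"
      using root_nonnegI[OF root[OF highest_root_in] i'(1)] i'(2) by (simp add: w0i_inv_coweight)
    then have "nonneg (- inv w0 (inv (w0i i) \<theta>))"
      using w0_inv_neg root highest_root_in by blast
    from alcove_nonneg[OF \<nu>A this] show ?thesis
      by (simp add: omega_apply i'(2) blinfun.minus_right)
  qed
  ultimately have "\<omega> i \<nu> \<in> A" by (simp add: alcove_def)
  then show ?thesis using ext_affine_stab[OF E \<nu>] by blast
qed

lemma stab_cases:
  assumes "\<phi> \<in> \<Omega>" shows "\<phi> = id \<or> (\<exists>i\<in>J. \<phi> = \<omega> i)"
  using stab_zero[OF assms]
proof
  assume "\<phi> 0 = 0"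
  then show ?thesis using stab_unique[OF assms stab_id] by simp
next
  assume "\<exists>i\<in>J. \<phi> 0 = cw i"
  then show ?thesis using stab_unique[OF assms omega_stab] omega_zero by metis
qed

lemma finite_stab: "finite \<Omega>"
proof (rule finite_subset)
  show "\<Omega> \<subseteq> insert id (\<omega> ` J)" using stab_cases by blast
  show "finite (insert id (\<omega> ` J))" by (simp add: J_def)
qed

section \<open>The fundamental domain\<close>

abbreviation F where "F \<equiv> F_coweight r \<alpha> \<theta> J"

text \<open>The set \<open>F\<close> consists of the points of the alcove where \<open>\<theta>\<close> is minimal on the \<open>\<Omega>\<close>-orbit.\<close>

lemma F_iff:
  fixes \<mu> :: "'a \<Rightarrow>\<^sub>L real"
  shows "\<mu> \<in> F \<longleftrightarrow> \<mu> \<in> A \<and> (\<forall>\<phi>\<in>\<Omega>. \<mu> \<theta> \<le> \<phi> \<mu> \<theta>)"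
proof -
  have special: "\<mu> (\<alpha> i + \<theta>) \<le> 1 \<longleftrightarrow> \<mu> \<theta> \<le> \<psi> \<mu> \<theta>"
    if "i \<in> J" "\<omega> i \<circ> \<psi> = id" for i \<psi>
  proof -
    have "\<omega> i (\<psi> \<mu>) = \<mu>" using that(2) by (metis comp_apply id_apply)
    then show ?thesis using omega_special[OF that(1), of "\<psi> \<mu>"] by (simp add: blinfun.add_right)
  qed
  show ?thesis
  proof
    assume \<mu>: "\<mu> \<in> F"
    have "\<mu> \<theta> \<le> \<phi> \<mu> \<theta>" if \<phi>: "\<phi> \<in> \<Omega>" for \<phi>
    proof -
      obtain \<psi> where \<psi>: "\<psi> \<in> \<Omega>" "\<psi> \<circ> \<phi> = id" "\<phi> \<circ> \<psi> = id" using stab_inverse[OF \<phi>] by blast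
      from stab_cases[OF \<psi>(1)] show ?thesis
      proof
        assume "\<psi> = id"
        then show ?thesis using \<psi>(2) by simp
      next
        assume "\<exists>i\<in>J. \<psi> = \<omega> i"
        then obtain i where i: "i \<in> J" "\<psi> = \<omega> i" by blast
        then have "\<mu> (\<alpha> i + \<theta>) \<le> 1" using \<mu> by (simp add: F_coweight_def)
        then show ?thesis using special[of i \<phi>] i \<psi>(2) by simp
      qed
    qed
    then show "\<mu> \<in> A \<and> (\<forall>\<phi>\<in>\<Omega>. \<mu> \<theta> \<le> \<phi> \<mu> \<theta>)"
      using \<mu> by (simp add: F_coweight_def)
  next
    assume \<mu>: "\<mu> \<in> A \<and> (\<forall>\<phi>\<in>\<Omega>. \<mu> \<theta> \<le> \<phi> \<mu> \<theta>)"
    have "\<mu> (\<alpha> i + \<theta>) \<le> 1" if i: "i \<in> J" for i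
    proof -
      obtain \<psi> where \<psi>: "\<psi> \<in> \<Omega>" "\<omega> i \<circ> \<psi> = id"
        using stab_inverse[OF omega_stab[OF i]] by blast
      then show ?thesis using special[OF i \<psi>(2)] \<mu> by blast
    qed
    then show "\<mu> \<in> F" using \<mu> by (simp add: F_coweight_def)
  qed
qed

lemma F_sub_alcove: "F \<subseteq> A"
  by (auto simp: F_coweight_def)

lemma stab_translates_cover: "A = (\<Union>\<phi>\<in>\<Omega>. \<phi> ` F)"
proof
  show "(\<Union>\<phi>\<in>\<Omega>. \<phi> ` F) \<subseteq> A" using F_sub_alcove stab_alcove by blast
  show "A \<subseteq> (\<Union>\<phi>\<in>\<Omega>. \<phi> ` F)"
  proof
    fix \<mu> assume \<mu>: "\<mu> \<in> A"
    have "\<Omega> \<noteq> {}" using stab_id by blast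
    then obtain \<phi> where \<phi>: "\<phi> \<in> \<Omega>" "\<And>\<psi>. \<psi> \<in> \<Omega> \<Longrightarrow> \<phi> \<mu> \<theta> \<le> \<psi> \<mu> \<theta>"
      using ex_is_arg_min_if_finite[OF finite_stab, of "\<lambda>\<phi>. blinfun_apply (\<phi> \<mu>) \<theta>"]
      unfolding is_arg_min_linorder by blast
    have "\<phi> \<mu> \<in> F"
      unfolding F_iff
    proof (intro conjI ballI)
      show "\<phi> \<mu> \<in> A" using stab_alcove \<phi>(1) \<mu> by blast
      show "\<phi> \<mu> \<theta> \<le> \<psi> (\<phi> \<mu>) \<theta>" if "\<psi> \<in> \<Omega>" for \<psi>
        using \<phi>(2)[OF stab_comp[OF that \<phi>(1)]] by simp
    qed
    moreover obtain \<psi> where \<psi>: "\<psi> \<in> \<Omega>" "\<psi> \<circ> \<phi> = id" using stab_inverse[OF \<phi>(1)] by blast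
    moreover have "\<mu> = \<psi> (\<phi> \<mu>)" using \<psi>(2) by (metis comp_apply id_apply)
    ultimately show "\<mu> \<in> (\<Union>\<phi>\<in>\<Omega>. \<phi> ` F)" by blast
  qed
qed

lemma F_translate_wall:
  fixes \<mu> :: "'a \<Rightarrow>\<^sub>L real"
  assumes i: "i \<in> J" and \<mu>: "\<mu> \<in> F" "\<mu> \<in> \<omega> i ` F"
  shows "\<mu> (\<alpha> i + \<theta>) = 1"
proof -
  obtain \<nu> where \<nu>: "\<nu> \<in> F" "\<mu> = \<omega> i \<nu>" using \<mu>(2) by blast
  have "\<nu> \<theta> \<le> \<mu> \<theta>" using \<nu> omega_stab[OF i] F_iff by blast
  moreover have "\<mu> (\<alpha> i) = 1 - \<nu> \<theta>" using omega_special[OF i] \<nu>(2) by simp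
  moreover have "\<mu> (\<alpha> i + \<theta>) \<le> 1" using \<mu>(1) i by (simp add: F_coweight_def)
  ultimately show ?thesis by (simp add: blinfun.add_right)
qed

lemma F_omega_inv_iff:
  fixes \<mu> :: "'a \<Rightarrow>\<^sub>L real"
  assumes i: "i \<in> J" and \<mu>: "\<mu> \<in> F"
  shows "inv (\<omega> i) \<mu> \<in> F \<longleftrightarrow> \<mu> (\<alpha> i + \<theta>) = 1"
proof -
  obtain \<psi> where \<psi>: "\<psi> \<in> \<Omega>" "\<psi> \<circ> \<omega> i = id" "\<omega> i \<circ> \<psi> = id"
    using stab_inverse[OF omega_stab[OF i]] by blast
  have inv: "inv (\<omega> i) = \<psi>" using inv_unique_comp[OF \<psi>(3,2)] .
  have undo: "\<omega> i (\<psi> \<mu>) = \<mu>" using \<psi>(3) by (metis comp_apply id_apply)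
  show ?thesis
    unfolding inv
  proof
    assume "\<psi> \<mu> \<in> F"
    then show "\<mu> (\<alpha> i + \<theta>) = 1" using F_translate_wall[OF i \<mu>] undo by (metis imageI)
  next
    assume "\<mu> (\<alpha> i + \<theta>) = 1"
    then have eq: "\<psi> \<mu> \<theta> = \<mu> \<theta>"
      using omega_special[OF i, of "\<psi> \<mu>"] undo by (simp add: blinfun.add_right)
    show "\<psi> \<mu> \<in> F"
      unfolding F_iff
    proof (intro conjI ballI)
      show "\<psi> \<mu> \<in> A" using stab_alcove[OF \<psi>(1)] \<mu> F_sub_alcove by blast
      fix \<phi> assume "\<phi> \<in> \<Omega>"
      then have "\<phi> \<circ> \<psi> \<in> \<Omega>" using stab_comp \<psi>(1) by blast
      then have "\<mu> \<theta> \<le> (\<phi> \<circ> \<psi>) \<mu> \<theta>" using \<mu> F_iff by blast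
      then show "\<psi> \<mu> \<theta> \<le> \<phi> (\<psi> \<mu>) \<theta>" using eq by simp
    qed
  qed
qed

lemma convex_alcove: "convex A"
  by (rule convexI) (auto simp: alcove_def blinfun.add_left blinfun.scaleR_left
      intro: add_nonneg_nonneg convex_bound_le)

lemma convex_F: "convex F"
proof (rule convexI)
  fix x y :: "'a \<Rightarrow>\<^sub>L real" and u v :: real
  assume *: "x \<in> F" "y \<in> F" "0 \<le> u" "0 \<le> v" "u + v = 1"
  then have "u *\<^sub>R x + v *\<^sub>R y \<in> A"
    using convexD[OF convex_alcove] F_sub_alcove by blast
  moreover have "(u *\<^sub>R x + v *\<^sub>R y) (\<alpha> i + \<theta>) \<le> 1" if "i \<in> J" for i
    using * that convex_bound_le[of "x (\<alpha> i + \<theta>)" 1 "y (\<alpha> i + \<theta>)" u v]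
    by (simp add: F_coweight_def blinfun.add_left blinfun.scaleR_left)
  ultimately show "u *\<^sub>R x + v *\<^sub>R y \<in> F" by (simp add: F_coweight_def)
qed

lemma closed_F: "closed F"
proof -
  have "F = (\<Inter>k\<in>{1..r}. {\<mu>. 0 \<le> blinfun_apply \<mu> (\<alpha> k)}) \<inter> {\<mu>. blinfun_apply \<mu> \<theta> \<le> 1} \<inter>
      (\<Inter>i\<in>J. {\<mu>. blinfun_apply \<mu> (\<alpha> i + \<theta>) \<le> 1})"
    by (auto simp: F_coweight_def alcove_def)
  also have "closed \<dots>"
    by (intro closed_Int closed_INT ballI closed_Collect_le continuous_intros)
  finally show ?thesis .
qed

text \<open>
  A subset of the alcove that lies in a hyperplane missing \<open>0\<close> has empty interior relative to
  the alcove: from any of its points, a segment towards \<open>0\<close> leaves the hyperplane at once.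
\<close>

lemma hyperplane_interior_empty:
  fixes T :: "('a \<Rightarrow>\<^sub>L real) set"
  assumes "T \<subseteq> A" "\<And>\<mu>. \<mu> \<in> T \<Longrightarrow> \<mu> b = 1"
  shows "(top_of_set A) interior_of T = {}"
proof (rule ccontr)
  assume "\<not> ?thesis"
  then obtain U \<mu> where U: "open U" "A \<inter> U \<subseteq> T" "\<mu> \<in> A" "\<mu> \<in> U"
    by (auto simp: interior_of_def openin_open)
  obtain e where e: "0 < e" "ball \<mu> e \<subseteq> U" using U(1,4) openE by blast
  define N where "N = norm \<mu> + 1"
  have N: "0 < N" "norm \<mu> \<le> N" by (auto simp: N_def intro: add_nonneg_pos)
  define t where "t = min 1 (e / (2 * N))"
  have t: "0 < t" "t \<le> 1" using e(1) N(1) by (auto simp: t_def)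
  let ?\<nu> = "(1 - t) *\<^sub>R \<mu>"
  have "?\<nu> = (1 - t) *\<^sub>R \<mu> + t *\<^sub>R 0" by simp
  also have "\<dots> \<in> A" by (rule convexD[OF convex_alcove U(3) zero_alcove]) (use t in auto)
  finally have "?\<nu> \<in> A" .
  moreover have "?\<nu> \<in> U"
  proof -
    have "t * norm \<mu> \<le> (e / (2 * N)) * N"
      using e(1) N by (intro mult_mono) (auto simp: t_def)
    also have "\<dots> = e / 2" using N(1) by simp
    also have "\<dots> < e" using e(1) by simp
    finally have "dist \<mu> ?\<nu> < e" using t by (simp add: dist_norm algebra_simps)
    then show ?thesis using e(2) by auto
  qed
  ultimately have "?\<nu> b = 1" using assms(2) U(2) by blast
  moreover have "\<mu> b = 1" using assms(2) U by blast
  ultimately show False using t by (simp add: blinfun.scaleR_left)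
qed

text \<open>
  A nonstrict linear inequality is strict at interior points, as the point can be moved in the
  direction of the functional \<open>x \<mapsto> x \<bullet> v\<close>, which is positive at \<open>v\<close>.
\<close>

lemma interior_less:
  fixes \<mu> :: "'a \<Rightarrow>\<^sub>L real"
  assumes "\<mu> \<in> interior T" "v \<noteq> 0" "\<And>\<nu>. \<nu> \<in> T \<Longrightarrow> \<nu> v \<le> c"
  shows "\<mu> v < c"
proof -
  obtain e where e: "0 < e" "ball \<mu> e \<subseteq> T" using assms(1) mem_interior by blast
  define d :: "'a \<Rightarrow>\<^sub>L real" where "d = Blinfun (\<lambda>x. x \<bullet> v)"
  have d: "d v = v \<bullet> v"
    unfolding d_def by (simp add: bounded_linear_Blinfun_apply bounded_linear_inner_left)
  define N where "N = norm d + 1"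
  have N: "0 < N" "norm d \<le> N" by (auto simp: N_def intro: add_nonneg_pos)
  define t where "t = e / (2 * N)"
  have t: "0 < t" using e(1) N(1) by (simp add: t_def)
  have "t * norm d \<le> t * N" using t N(2) by simp
  also have "\<dots> = e / 2" using N(1) by (simp add: t_def)
  also have "\<dots> < e" using e(1) by simp
  finally have "\<mu> + t *\<^sub>R d \<in> T" using e(2) t by (auto simp: dist_norm subset_iff)
  then have "\<mu> v + t * (v \<bullet> v) \<le> c"
    using assms(3) d by (metis blinfun.add_left blinfun.scaleR_left real_scaleR_def)
  moreover have "0 < t * (v \<bullet> v)" using t assms(2) by simp
  ultimately show ?thesis by simp
qed

lemma simple_plus_highest_nonzero: "i \<in> {1..r} \<Longrightarrow> \<alpha> i + \<theta> \<noteq> 0"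
proof
  assume i: "i \<in> {1..r}" and "\<alpha> i + \<theta> = 0"
  then have "cw i (\<alpha> i + \<theta>) = 0" by simp
  then show False using i coweight_highest_root_ge[OF i] by (simp add: blinfun.add_right coweight_simple)
qed

lemma interior_F:
  fixes \<mu> :: "'a \<Rightarrow>\<^sub>L real"
  assumes "\<mu> \<in> interior F"
  shows "\<mu> \<in> open_alcove" and "i \<in> J \<Longrightarrow> \<mu> (\<alpha> i + \<theta>) < 1"
proof -
  have "\<mu> (- \<alpha> k) < 0" if "k \<in> {1..r}" for k
    by (rule interior_less[OF assms])
      (use simple_nonzero[OF that] that in \<open>auto simp: F_coweight_def alcove_def blinfun.minus_right\<close>)
  moreover have "\<mu> \<theta> < 1"
    by (rule interior_less[OF assms])
      (use highest_root_in zero_not_root in \<open>auto simp: F_coweight_def alcove_def\<close>)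
  ultimately show "\<mu> \<in> open_alcove" by (simp add: open_alcove_def blinfun.minus_right)
  assume i: "i \<in> J"
  then have "i \<in> {1..r}" by (simp add: J_def)
  then show "\<mu> (\<alpha> i + \<theta>) < 1"
    by (intro interior_less[OF assms] simple_plus_highest_nonzero) (use i in \<open>auto simp: F_coweight_def\<close>)
qed

lemma interior_F_moved:
  fixes \<mu> :: "'a \<Rightarrow>\<^sub>L real" and \<phi> :: "('a \<Rightarrow>\<^sub>L real) \<Rightarrow> ('a \<Rightarrow>\<^sub>L real)"
  assumes \<mu>: "\<mu> \<in> interior F" and \<phi>: "\<phi> \<in> E" "\<phi> \<noteq> id"
  shows "\<phi> \<mu> \<notin> F"
proof
  assume F: "\<phi> \<mu> \<in> F"
  have "\<phi> \<in> \<Omega>" using ext_affine_stab[OF \<phi>(1) interior_F(1)[OF \<mu>]] F F_sub_alcove by blast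
  then obtain \<psi> where \<psi>: "\<psi> \<in> \<Omega>" "\<psi> \<circ> \<phi> = id" "\<phi> \<circ> \<psi> = id" using stab_inverse by blast
  have "\<psi> \<noteq> id" using \<psi>(2) \<phi>(2) by auto
  then obtain i where i: "i \<in> J" "\<psi> = \<omega> i" using stab_cases[OF \<psi>(1)] by blast
  have "\<mu> = \<omega> i (\<phi> \<mu>)" using \<psi>(2) i(2) by (metis comp_apply id_apply)
  then have "\<mu> \<in> \<omega> i ` F" using F by blast
  then have "\<mu> (\<alpha> i + \<theta>) = 1" using F_translate_wall[OF i(1)] \<mu> interior_subset by blast
  then show False using interior_F(2)[OF \<mu> i(1)] by simp
qed

lemma stab_acts: "acts_on \<Omega> (top_of_set A)"
proof -
  have "homeomorphic_map (top_of_set A) (top_of_set A) \<phi>" if \<phi>: "\<phi> \<in> \<Omega>" for \<phi>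
  proof -
    obtain \<psi> where \<psi>: "\<psi> \<in> \<Omega>" "\<psi> \<circ> \<phi> = id" "\<phi> \<circ> \<psi> = id" using stab_inverse[OF \<phi>] by blast
    have cont: "continuous_map (top_of_set A) (top_of_set A) \<xi>" if "\<xi> \<in> \<Omega>" for \<xi>
      using ext_affine_continuous[OF stab_ext[OF that]] stab_alcove[OF that] by auto
    have "homeomorphic_maps (top_of_set A) (top_of_set A) \<phi> \<psi>"
      unfolding homeomorphic_maps_def
      using cont \<phi> \<psi>(1) fun_cong[OF \<psi>(2)] fun_cong[OF \<psi>(3)] by simp
    then show ?thesis using homeomorphic_map_maps by blast
  qed
  then show ?thesis
    unfolding acts_on_def using stab_id stab_comp stab_inverse by blast
qed

lemma F_fundamental_domain: "fundamental_domain \<Omega> (top_of_set A) F"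
  unfolding fundamental_domain_def
proof (intro conjI ballI impI)
  show "acts_on \<Omega> (top_of_set A)" by (rule stab_acts)
  show "closedin (top_of_set A) F"
    using closed_F F_sub_alcove by (rule closed_subset[rotated])
  show "connectedin (top_of_set A) F"
    using convex_connected[OF convex_F] F_sub_alcove by (simp add: connectedin_subtopology)
  show "topspace (top_of_set A) = (\<Union>\<phi>\<in>\<Omega>. \<phi> ` F)" using stab_translates_cover by simp
  fix \<phi> assume "\<phi> \<in> \<Omega>" "\<phi> \<noteq> id"
  then obtain i where i: "i \<in> J" "\<phi> = \<omega> i" using stab_cases by blast
  show "top_of_set A interior_of (F \<inter> \<phi> ` F) = {}"
    by (rule hyperplane_interior_empty[of _ "\<alpha> i + \<theta>"])
      (use F_sub_alcove F_translate_wall[OF i(1)] i(2) in auto)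
qed

end

theorem proposition2p2p3:
  fixes \<Phi> :: "'a::euclidean_space set" and r :: nat and \<alpha> :: "nat \<Rightarrow> 'a"
    and \<alpha>\<^sub>0 :: 'a and n :: "nat \<Rightarrow> real" and J :: "nat set"
  assumes "root_system \<Phi>" and "reduced_roots \<Phi>" and "crystallographic \<Phi>" and "irreducible_roots \<Phi>"
    and "simple_system \<Phi> r \<alpha>"
    and "highest_root \<Phi> r \<alpha> \<alpha>\<^sub>0"
    and "\<alpha>\<^sub>0 = (\<Sum>i\<in>{1..r}. n i *\<^sub>R \<alpha> i)"
    and "J = {i \<in> {1..r}. n i = 1}"
  shows "fundamental_domain (alcove_stab \<Phi> r \<alpha> \<alpha>\<^sub>0) (top_of_set (alcove r \<alpha> \<alpha>\<^sub>0))
           (F_coweight r \<alpha> \<alpha>\<^sub>0 J) \<and>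
         (\<forall>\<mu> \<in> F_coweight r \<alpha> \<alpha>\<^sub>0 J. \<forall>i\<in>J.
            inv (omega \<Phi> r \<alpha> i) \<mu> \<in> F_coweight r \<alpha> \<alpha>\<^sub>0 J \<longleftrightarrow>
            blinfun_apply \<mu> (\<alpha> i + \<alpha>\<^sub>0) = 1) \<and>
         (\<forall>\<mu> \<in> interior (F_coweight r \<alpha> \<alpha>\<^sub>0 J). \<forall>\<phi> \<in> ext_affine_weyl \<Phi> r \<alpha>.
            \<phi> \<noteq> id \<longrightarrow> \<phi> \<mu> \<notin> F_coweight r \<alpha> \<alpha>\<^sub>0 J)"
proof -
  interpret R: based_root_system_highest \<Phi> r \<alpha> \<alpha>\<^sub>0
    using assms(1-3,5,6) by unfold_locales
  have "coweight r \<alpha> i \<alpha>\<^sub>0 = n i" if "i \<in> {1..r}" for i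
    using R.coweight_sum[OF that] assms(7) by simp
  then have J: "J = R.J" unfolding R.J_def assms(8) by auto
  show ?thesis
    unfolding J using R.F_fundamental_domain R.F_omega_inv_iff R.interior_F_moved by blast
qed

end
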